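(* Let $n\ge 2$ and let $B_n$ be the hyperoctahedral group of permutations $w$ of $\pm[n]=\{\bar n,\ldots,\bar1,1,\ldots,n\}$ with $w(\bar i)=\overline{w(i)}$, regarded as the Coxeter group of type $B_n$. Fix the Coxeter element $c=(\bar1\,\bar2\,\cdots\,\bar n\,1\,2\,\cdots\,n)$. Then: (1) $c^{-1}$ has $2n-1$ antiexceedances; (2) every element of $B_n$ other than $c^{-1}$ has at most $2n-2$ antiexceedances; (3) for every $w\in B_n$, $\mathrm{aexc}(\mathsf{Pop}_T(w,c))=\mathrm{aexc}(w)-\mathrm{cyc}_{>1}(\pi_T(w,c))$.
   Context: Bars denote negatives ($\bar i=-i$). The reflections $T$ of $B_n$ are the elements $(i\,j)(\bar i\,\bar j)$ with $i\neq\pm j$ and $(i\,\bar i)$. Define the total order $\bar1\prec\bar2\prec\cdots\prec\bar n\prec1\prec2\prec\cdots\prec n$ on $\pm[n]$. An antiexceedance of $w\in B_n$ is an element $i\in\pm[n]$ with $i\prec w^{-1}(i)$; $\mathrm{aexc}(w)$ is their number. $\mathrm{cyc}_{>1}(w)$ is the number of non-singleton cycles of $w$ as a permutation of $\pm[n]$. $\ell_T(w)$ is the minimal number of reflections with product $w$; absolute order $v\le_T w$ iff $\ell_T(wv^{-1})=\ell_T(w)-\ell_T(v)$. $\mathrm{NC}(B_n,c)=[e,c]$ in absolute order, a lattice with join $\bigvee$. $\pi_T(w,c)=\bigvee_{t\in T,\ t\le_T w}t$ (join in $\mathrm{NC}(B_n,c)$, empty join $=e$) and $\mathsf{Pop}_T(w,c)=w\,\pi_T(w,c)^{-1}$.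 *)

theory Defs
  imports "HOL-Algebra.Lattice" "HOL-Combinatorics.Cycles" "HOL-Combinatorics.Orbits"
begin

text \<open>The barred letter \<open>i\<close> is the integer \<open>-i\<close>. Elements of the hyperoctahedral group are
  functions on all integers that fix everything outside \<open>pm n\<close>; the product \<open>v w\<close> is
  \<open>v \<circ> w\<close> and the inverse is \<^term>\<open>inv\<close>.\<close>

definition pm :: "nat \<Rightarrow> int set" where
  "pm n = {- int n .. int n} - {0}"

definition hyperoctahedral :: "nat \<Rightarrow> (int \<Rightarrow> int) set" where
  "hyperoctahedral n = {w. w permutes pm n \<and> (\<forall>i\<in>pm n. w (- i) = - w i)}"

definition reflections :: "nat \<Rightarrow> (int \<Rightarrow> int) set" where
  "reflections n =
     {transpose i j \<circ> transpose (- i) (- j) | i j. i \<in> pm n \<and> j \<in> pm n \<and> i \<noteq> j \<and> i \<noteq> - j}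
     \<union> {transpose i (- i) | i. i \<in> pm n}"

definition reflection_length :: "nat \<Rightarrow> (int \<Rightarrow> int) \<Rightarrow> nat" where
  "reflection_length n w =
     (LEAST k. \<exists>ts. length ts = k \<and> set ts \<subseteq> reflections n \<and> foldr (\<circ>) ts id = w)"

text \<open>The difference of lengths is taken in the integers, to avoid truncated subtraction.\<close>

definition absolute_le :: "nat \<Rightarrow> (int \<Rightarrow> int) \<Rightarrow> (int \<Rightarrow> int) \<Rightarrow> bool" where
  "absolute_le n v w \<longleftrightarrow>
     int (reflection_length n (w \<circ> inv v)) =
       int (reflection_length n w) - int (reflection_length n v)"

definition NC :: "nat \<Rightarrow> (int \<Rightarrow> int) \<Rightarrow> (int \<Rightarrow> int) gorder" where
  "NC n c =
     \<lparr>carrier = {w \<in> hyperoctahedral n. absolute_le n id w \<and> absolute_le n w c},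
      eq = (=), le = absolute_le n\<rparr>"

definition pi_T :: "nat \<Rightarrow> (int \<Rightarrow> int) \<Rightarrow> (int \<Rightarrow> int) \<Rightarrow> (int \<Rightarrow> int)" where
  "pi_T n w c = \<Squnion>\<^bsub>NC n c\<^esub> {t \<in> reflections n. absolute_le n t w}"

definition Pop_T :: "nat \<Rightarrow> (int \<Rightarrow> int) \<Rightarrow> (int \<Rightarrow> int) \<Rightarrow> (int \<Rightarrow> int)" where
  "Pop_T n w c = w \<circ> inv (pi_T n w c)"

text \<open>The order \<open>-1 \<prec> -2 \<prec> \<dots> \<prec> -n \<prec> 1 \<prec> 2 \<prec> \<dots> \<prec> n\<close>.\<close>

definition prec :: "int \<Rightarrow> int \<Rightarrow> bool" where
  "prec i j \<longleftrightarrow> (i < 0 \<and> 0 < j) \<or> (sgn i = sgn j \<and> \<bar>i\<bar> < \<bar>j\<bar>)"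

definition aexc :: "nat \<Rightarrow> (int \<Rightarrow> int) \<Rightarrow> nat" where
  "aexc n w = card {i \<in> pm n. prec i (inv w i)}"

text \<open>A cycle is identified with its underlying set, an orbit of the permutation.\<close>

definition cyc_gt1 :: "nat \<Rightarrow> (int \<Rightarrow> int) \<Rightarrow> nat" where
  "cyc_gt1 n w = card {C \<in> orbit w ` pm n. card C > 1}"

definition coxeter_element :: "nat \<Rightarrow> (int \<Rightarrow> int)" where
  "coxeter_element n = cycle_of_list (map uminus [1..int n] @ [1..int n])"

end

theory Submission
  imports Defs
begin

text \<open>Write \<open>x < y\<close> for the order on \<open>\<plusminus>[n]\<close> given by \<open>prec\<close>. A permutation has at least one weak drop
  \<open>u i \<le> i\<close> in each cycle, and it has exactly one in each cycle iff it rotates every cycle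
  increasingly (\<open>rotational\<close>). The weak drops of \<open>u\<close> and of \<open>c u\<^sup>-\<^sup>1\<close> number \<open>2 n + 1\<close> together, so a
  geodesic from the identity to \<open>c\<close> runs through rotational permutations; a descent on the width
  of a crossing shows that their cycles do not cross. Conversely, for rotations of noncrossing
  partitions, refinement implies the absolute order. Hence \<open>\<pi>\<^sub>T(w, c)\<close> rotates the blocks of the
  noncrossing closure of the cycles of \<open>w\<close>. These blocks are preserved by \<open>w\<close>, and a fixed point
  of \<open>w\<close> is a singleton block, because removing a point from its block keeps a partition
  noncrossing. Therefore \<open>w j < j\<close> holds iff \<open>w j < \<pi> j\<close> or \<open>\<pi> j < j\<close>, the alternatives exclude each
  other, and the second one occurs once in every nontrivial cycle of \<open>\<pi>\<close>.\<close>

subsection \<open>Orbits of permutations of a ranked set\<close>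

text \<open>The count of weak drops lives in the symmetric group on \<open>2 n\<close> letters,
  whereas geodesics are measured by the reflection length of \<open>B_n\<close>, which is not a
  function of the number of cycles alone. The discrepancy comes from balanced cycles, those with
  \<open>Q = -Q\<close>: twice the length plus the number of cycles equals \<open>2 n\<close> plus
  the number of balanced cycles. For \<open>u\<close> below \<open>c\<close>, the cycles of
  \<open>u\<close> and of \<open>c u^-1\<close> therefore number \<open>2 n\<close> plus their
  balanced cycles. The weak drops allow at most one balanced cycle in all, and a sign character,
  trivial on elements without balanced cycles but \<open>-1\<close> at \<open>c\<close>, rules out
  zero. With exactly one, the geodesic is also one of the symmetric group. In the converse direction
  balanced cycles are controlled geometrically: negation is the half turn of a circle of
  \<open>2 n\<close> points, so two balanced blocks would contain crossing diameters. For the same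
  reason a reflection below \<open>w\<close> that links two balanced cycles adds nothing to the
  noncrossing closure.\<close>

lemma ex_max_value:
  fixes f :: "'a \<Rightarrow> nat"
  assumes "finite A" "A \<noteq> {}"
  obtains m where "m \<in> A" "\<And>y. y \<in> A \<Longrightarrow> f y \<le> f m"
proof -
  have "Max (f ` A) \<in> f ` A" using assms by simp
  then obtain m where "m \<in> A" "f m = Max (f ` A)" by auto
  then show ?thesis using that assms(1) by simp
qed

lemma ex_min_value:
  fixes f :: "'a \<Rightarrow> nat"
  assumes "A \<noteq> {}"
  obtains m where "m \<in> A" "\<And>y. y \<in> A \<Longrightarrow> f m \<le> f y"
  using assms ex_has_least_nat[of "\<lambda>x. x \<in> A" _ f] by blast

locale ranked_set =
  fixes X :: "'a set" and k :: "'a \<Rightarrow> nat"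
  assumes finite_X: "finite X" and inj_k: "inj_on k X"
begin

section \<open>Weak drops and increasing rotation of cycles\<close>

definition wdrop :: "('a \<Rightarrow> 'a) \<Rightarrow> 'a set" where
  "wdrop u = {i \<in> X. k (u i) \<le> k i}"

definition ncyc :: "('a \<Rightarrow> 'a) \<Rightarrow> nat" where
  "ncyc u = card (orbit u ` X)"

text \<open>Demanding that every weak drop be the maximum of its cycle already forces
  \<open>u\<close> to climb through each cycle without skipping a point and to return from the
  maximum to the minimum.\<close>

definition rotational :: "('a \<Rightarrow> 'a) \<Rightarrow> bool" where
  "rotational u \<longleftrightarrow> u permutes X \<and> (\<forall>i \<in> wdrop u. \<forall>y \<in> orbit u i. k y \<le> k i)"

definition noncrossing :: "('a \<Rightarrow> 'a) \<Rightarrow> bool" where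
  "noncrossing u \<longleftrightarrow> (\<forall>a\<in>X. \<forall>b\<in>X. \<forall>c\<in>orbit u a. \<forall>d\<in>orbit u b.
     k a < k b \<longrightarrow> k b < k c \<longrightarrow> k c < k d \<longrightarrow> b \<in> orbit u a)"

lemma k_eqD: "k x = k y \<Longrightarrow> x \<in> X \<Longrightarrow> y \<in> X \<Longrightarrow> x = y"
  using inj_k by (auto dest: inj_onD)

lemma permutation_if_permutes: "u permutes X \<Longrightarrow> permutation u"
  using finite_X by (auto simp: permutation_permutes)

lemma self_in_orbit: "u permutes X \<Longrightarrow> i \<in> orbit u i"
  by (simp add: permutation_if_permutes permutation_self_in_orbit)

lemma orbit_in_X: "u permutes X \<Longrightarrow> i \<in> X \<Longrightarrow> y \<in> orbit u i \<Longrightarrow> y \<in> X"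
  using permutes_orbit_subset by fastforce

lemma orbit_eq: "u permutes X \<Longrightarrow> y \<in> orbit u i \<Longrightarrow> orbit u y = orbit u i"
  by (metis orbit_swap orbit_trans self_in_orbit subsetI subset_antisym)

lemma orbit_inv_closed: "u permutes X \<Longrightarrow> y \<in> orbit u i \<Longrightarrow> inv u y \<in> orbit u i"
  by (metis orbit.base orbit_eq permutes_inverses(1) self_in_orbit)

lemma rotational_permutes: "rotational u \<Longrightarrow> u permutes X"
  by (simp add: rotational_def)

lemma rotational_max:
  "rotational u \<Longrightarrow> i \<in> X \<Longrightarrow> k (u i) \<le> k i \<Longrightarrow> y \<in> orbit u i \<Longrightarrow> k y \<le> k i"
  by (auto simp: rotational_def wdrop_def)

lemma finite_orbit_X: "u permutes X \<Longrightarrow> i \<in> X \<Longrightarrow> finite (orbit u i)"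
  by (simp add: finite_orbit self_in_orbit)

lemma ex_orbit_max:
  assumes "u permutes X" "i \<in> X"
  obtains m where "m \<in> orbit u i" "m \<in> wdrop u" "\<And>y. y \<in> orbit u i \<Longrightarrow> k y \<le> k m"
proof -
  have f: "finite (orbit u i)" "orbit u i \<noteq> {}"
    using assms by (auto simp: orbit_nonempty finite_orbit_X)
  obtain m where m: "m \<in> orbit u i" "\<And>y. y \<in> orbit u i \<Longrightarrow> k y \<le> k m"
    using ex_max_value[OF f] by metis
  have "m \<in> wdrop u"
    using m assms orbit_in_X by (auto simp: wdrop_def intro: orbit.step)
  then show ?thesis using that m by blast
qed

lemma orbits_eq_image_wdrop: "u permutes X \<Longrightarrow> orbit u ` X = orbit u ` wdrop u"
proof
  assume u: "u permutes X"
  show "orbit u ` X \<subseteq> orbit u ` wdrop u"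
  proof
    fix Q assume "Q \<in> orbit u ` X"
    then obtain i where i: "i \<in> X" "Q = orbit u i" by auto
    obtain m where "m \<in> orbit u i" "m \<in> wdrop u" using ex_orbit_max[OF u i(1)] by metis
    then show "Q \<in> orbit u ` wdrop u" using orbit_eq[OF u] i by auto
  qed
qed (auto simp: wdrop_def)

lemma finite_wdrop: "finite (wdrop u)"
  using finite_X by (simp add: wdrop_def)

lemma ncyc_le_card_wdrop: "u permutes X \<Longrightarrow> ncyc u \<le> card (wdrop u)"
  by (simp add: ncyc_def orbits_eq_image_wdrop card_image_le finite_wdrop)

text \<open>Each cycle has a weak drop at its maximum, so equality of the two counts means that no
  cycle contains a second one.\<close>

lemma rotational_iff:
  assumes u: "u permutes X"
  shows "rotational u \<longleftrightarrow> ncyc u = card (wdrop u)"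
proof -
  have "rotational u \<longleftrightarrow> inj_on (orbit u) (wdrop u)"
  proof
    assume r: "rotational u"
    show "inj_on (orbit u) (wdrop u)"
    proof (rule inj_onI)
      fix i j assume ij: "i \<in> wdrop u" "j \<in> wdrop u" "orbit u i = orbit u j"
      have "k i \<le> k j" "k j \<le> k i"
        using ij r self_in_orbit[OF u] by (auto simp: rotational_def)
      then show "i = j" using ij by (intro k_eqD) (auto simp: wdrop_def)
    qed
  next
    assume inj: "inj_on (orbit u) (wdrop u)"
    show "rotational u"
      unfolding rotational_def
    proof (intro conjI ballI u)
      fix i y assume i: "i \<in> wdrop u" and y: "y \<in> orbit u i"
      have iX: "i \<in> X" using i by (simp add: wdrop_def)
      obtain m where m: "m \<in> orbit u i" "m \<in> wdrop u" "\<And>y. y \<in> orbit u i \<Longrightarrow> k y \<le> k m"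
        using ex_orbit_max[OF u iX] by metis
      have "m = i" using inj m(1,2) i orbit_eq[OF u] by (auto dest: inj_onD)
      then show "k y \<le> k i" using m y by blast
    qed
  qed
  then show ?thesis
    by (metis ncyc_def eq_card_imp_inj_on card_image finite_wdrop orbits_eq_image_wdrop u)
qed

text \<open>The preimage of the minimum of the cycle is a weak drop, hence the maximum, hence
  \<open>i\<close> itself.\<close>

lemma rotational_min:
  assumes r: "rotational u" and i: "i \<in> X" "k (u i) \<le> k i" and y: "y \<in> orbit u i"
  shows "k (u i) \<le> k y"
proof -
  note u = rotational_permutes[OF r]
  have f: "finite (orbit u i)" "orbit u i \<noteq> {}"
    using i u by (auto simp: orbit_nonempty finite_orbit_X)
  obtain m where m: "m \<in> orbit u i" "\<And>y. y \<in> orbit u i \<Longrightarrow> k m \<le> k y"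
    using ex_min_value[OF f(2)] by metis
  define j where "j = inv u m"
  have j: "j \<in> orbit u i" "u j = m" "j \<in> X"
    using orbit_inv_closed[OF u m(1)] orbit_in_X[OF u i(1)] permutes_inverses(1)[OF u]
    by (auto simp: j_def)
  have "k y \<le> k j" if "y \<in> orbit u i" for y
    using rotational_max[OF r j(3)] m j that orbit_eq[OF u j(1)] by auto
  moreover have "k y \<le> k i" if "y \<in> orbit u i" for y
    using rotational_max[OF r i that] .
  ultimately have "i = j" using j i self_in_orbit[OF u] by (intro k_eqD) (auto intro: antisym)
  then show ?thesis using j m y by simp
qed

text \<open>Let \<open>m\<close> be the lowest cycle point skipped by the rise at \<open>i\<close>.
  Its preimage \<open>j\<close> is not a weak drop and not among the skipped points, so it lies
  below \<open>i\<close>. Then the rise from \<open>j\<close> to \<open>m\<close> skips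
  \<open>i\<close>, which is the same situation at a lower point.\<close>

lemma rotational_no_between:
  assumes r: "rotational u"
  shows "i \<in> X \<Longrightarrow> y \<in> orbit u i \<Longrightarrow> k i < k y \<Longrightarrow> \<not> k y < k (u i)"
proof (induction "k i" arbitrary: i y rule: less_induct)
  case less
  note u = rotational_permutes[OF r]
  show ?case
  proof
    assume "k y < k (u i)"
    define E where "E = {z \<in> orbit u i. k i < k z \<and> k z < k (u i)}"
    have "finite E" "E \<noteq> {}"
      using less finite_orbit_X[OF u] \<open>k y < k (u i)\<close> by (auto simp: E_def)
    then obtain m where m: "m \<in> E" "\<And>z. z \<in> E \<Longrightarrow> k m \<le> k z"
      using ex_min_value by metis
    define j where "j = inv u m"
    have mo: "m \<in> orbit u i" using m E_def by auto
    have j: "j \<in> orbit u i" "u j = m" "j \<in> X"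
      using orbit_inv_closed[OF u mo] orbit_in_X[OF u less(2)] permutes_inverses(1)[OF u]
      by (auto simp: j_def)
    have io: "i \<in> orbit u j" using orbit_eq[OF u j(1)] self_in_orbit[OF u] by auto
    have "j \<noteq> i" using m j by (auto simp: E_def)
    have jm: "k j < k m"
    proof (rule ccontr)
      assume "\<not> ?thesis"
      then have "k (u j) \<le> k i" using rotational_min[OF r j(3) _ io] j by simp
      then show False using m j by (auto simp: E_def)
    qed
    have "k j \<le> k i" using m(2)[of j] jm m(1) j by (fastforce simp: E_def)
    then have "k j < k i" using k_eqD[of j i] j less(2) \<open>j \<noteq> i\<close> by fastforce
    then show False using less(1)[OF _ j(3) io] m j by (auto simp: E_def)
  qed
qed

text \<open>Maximum, minimum and absence of skipped points pin \<open>u i\<close> down as the cyclic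
  successor of \<open>i\<close> in its cycle.\<close>

lemma rotational_unique:
  assumes r: "rotational u" "rotational v" and o: "\<And>i. i \<in> X \<Longrightarrow> orbit u i = orbit v i"
  shows "u = v"
proof
  fix i
  note p = rotational_permutes[OF r(1)] rotational_permutes[OF r(2)]
  show "u i = v i"
  proof (cases "i \<in> X")
    case True
    note uX = orbit_in_X[OF p(1) True orbit.base] and vX = orbit_in_X[OF p(2) True orbit.base]
    have ou: "u i \<in> orbit v i" "v i \<in> orbit u i" using o[OF True] orbit.base[of u i] orbit.base[of v i] by auto
    note mx = rotational_max[OF r(1) True _ ou(2)] rotational_max[OF r(2) True _ ou(1)]
    note mn = rotational_min[OF r(1) True _ ou(2)] rotational_min[OF r(2) True _ ou(1)]
    note nb = rotational_no_between[OF r(1) True ou(2)] rotational_no_between[OF r(2) True ou(1)]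
    have "k (u i) = k (v i)" using mx mn nb by linarith
    then show ?thesis using uX vX k_eqD by blast
  next
    case False
    then show ?thesis using p by (simp add: permutes_def)
  qed
qed

section \<open>Quotients of rotations and geodesics to a full cycle\<close>

text \<open>Substituting \<open>y = u i\<close> turns weak drops of the quotient into comparisons of
  \<open>v i\<close> with \<open>u i\<close>. Since \<open>v i\<close> is the cyclic successor of
  \<open>i\<close> in a block that contains \<open>u i\<close>, \<open>k (v i) \<le> k (u i)\<close>
  holds iff \<open>u\<close> rises at \<open>i\<close> or \<open>v\<close> drops weakly at
  \<open>i\<close>, and never for both reasons.\<close>

lemma card_wdrop_quotient:
  assumes r: "rotational v" and u: "u permutes X" and uv: "\<And>i. i \<in> X \<Longrightarrow> u i \<in> orbit v i"
  shows "card (wdrop (v \<circ> inv u)) + card (wdrop u) = card X + card (wdrop v)"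
proof -
  let ?U = "{i \<in> X. k i < k (u i)}"
  have "wdrop (v \<circ> inv u) = u ` {i \<in> X. k (v i) \<le> k (u i)}"
  proof (intro equalityI subsetI)
    fix y assume y: "y \<in> wdrop (v \<circ> inv u)"
    show "y \<in> u ` {i \<in> X. k (v i) \<le> k (u i)}"
      by (rule image_eqI[of _ _ "inv u y"])
        (use y permutes_inverses[OF u] permutes_in_image[OF permutes_inv[OF u]] in
          \<open>auto simp: wdrop_def\<close>)
  qed (use permutes_in_image[OF u] permutes_inverses[OF u] in \<open>auto simp: wdrop_def\<close>)
  then have 1: "card (wdrop (v \<circ> inv u)) = card {i \<in> X. k (v i) \<le> k (u i)}"
    by (simp add: card_image permutes_inj_on[OF u])
  have "{i \<in> X. k (v i) \<le> k (u i)} = ?U \<union> wdrop v"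
  proof -
    have "k (v i) \<le> k (u i) \<longleftrightarrow> k i < k (u i) \<or> k (v i) \<le> k i" if "i \<in> X" for i
      using rotational_max[OF r that _ uv[OF that]] rotational_min[OF r that _ uv[OF that]]
        rotational_no_between[OF r that uv[OF that]] by linarith
    then show ?thesis by (auto simp: wdrop_def)
  qed
  moreover have "?U \<inter> wdrop v = {}"
    using rotational_max[OF r _ _ uv] by (fastforce simp: wdrop_def)
  ultimately have 2: "card {i \<in> X. k (v i) \<le> k (u i)} = card ?U + card (wdrop v)"
    using finite_X by (simp add: card_Un_disjoint finite_wdrop)
  have "?U \<union> wdrop u = X" "?U \<inter> wdrop u = {}" by (auto simp: wdrop_def)
  then have "card ?U + card (wdrop u) = card X"
    using finite_X card_Un_disjoint[of ?U "wdrop u"] finite_wdrop by simp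
  then show ?thesis using 1 2 by simp
qed

definition full_rotation :: "('a \<Rightarrow> 'a) \<Rightarrow> bool" where
  "full_rotation c \<longleftrightarrow> rotational c \<and> (\<forall>i\<in>X. orbit c i = X)"

text \<open>The quotient cycle through the jump of \<open>u\<close> over \<open>b\<close> produces a
  step of \<open>u\<close> from some \<open>z\<close> above \<open>b\<close> down to some
  \<open>y\<close> below \<open>b\<close>, both strictly inside the old chord. The points
  \<open>y\<close>, \<open>b\<close>, \<open>z\<close>, \<open>d\<close> form a narrower
  crossing.\<close>

lemma geodesic_no_crossing:
  assumes c: "full_rotation c" and ru: "rotational u" and rx: "rotational (c \<circ> inv u)"
  shows "a \<in> X \<Longrightarrow> b \<in> X \<Longrightarrow> e \<in> orbit u a \<Longrightarrow> d \<in> orbit u b \<Longrightarrow> k a < k b \<Longrightarrow> k b < k e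
    \<Longrightarrow> k e < k d \<Longrightarrow> b \<in> orbit u a"
proof (induction "k e - k a" arbitrary: a e rule: less_induct)
  case less
  note u = rotational_permutes[OF ru] and x = rotational_permutes[OF rx]
  have rc: "rotational c" and oc: "\<And>i. i \<in> X \<Longrightarrow> orbit c i = X"
    using c by (auto simp: full_rotation_def)
  note cp = rotational_permutes[OF rc]
  note aX = less(2) and bX = less(3) and e = less(4) and d = less(5) and lt = less(6-8)
  let ?x = "c \<circ> inv u"
  show ?case
  proof (rule ccontr)
    assume nb: "b \<notin> orbit u a"
    \<comment> \<open>\<open>a1\<close> is the last point of the cycle below \<open>b\<close>, so
      \<open>a2 = u a1\<close> is where this cycle jumps over \<open>b\<close>.\<close>
    define A where "A = {y \<in> orbit u a. k y < k b}"
    have "finite A" "A \<noteq> {}" "a \<in> A"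
      using finite_orbit_X[OF u aX] lt self_in_orbit[OF u] by (auto simp: A_def)
    then obtain a1 where a1: "a1 \<in> A" "\<And>y. y \<in> A \<Longrightarrow> k y \<le> k a1"
      using ex_max_value by metis
    have a1o: "a1 \<in> orbit u a" "a1 \<in> X" "k a1 < k b" "k a \<le> k a1"
      using a1 \<open>a \<in> A\<close> orbit_in_X[OF u aX] by (auto simp: A_def)
    have eo: "e \<in> orbit u a1" using orbit_eq[OF u a1o(1)] e by simp
    define a2 where "a2 = u a1"
    have a2o: "a2 \<in> orbit u a" "a2 \<in> X"
      using orbit.step[OF a1o(1)] orbit_in_X[OF u aX] by (auto simp: a2_def)
    have up: "k a1 < k a2"
      using rotational_max[OF ru a1o(2) _ eo] lt a1o by (fastforce simp: a2_def)
    have "k b < k a2"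
    proof (rule ccontr)
      assume "\<not> ?thesis"
      moreover have "k a2 \<noteq> k b" using k_eqD[of a2 b] a2o bX nb by auto
      ultimately have "a2 \<in> A" using a2o by (auto simp: A_def)
      then show False using a1 up by fastforce
    qed
    have "k a2 \<le> k e"
      using rotational_no_between[OF ru a1o(2) eo] a1o lt by (fastforce simp: a2_def)
    have cX: "y \<in> X \<Longrightarrow> c y \<in> X" for y using cp by (simp add: permutes_in_image)
    have ca1: "k a1 < k (c a1)"
      using rotational_max[OF rc a1o(2), of b] oc[OF a1o(2)] bX a1o by fastforce
    have ca1b: "k (c a1) \<le> k b"
      using rotational_no_between[OF rc a1o(2), of b] oc[OF a1o(2)] bX a1o by fastforce
    have xa2: "?x a2 = c a1" using permutes_inverses(2)[OF u] by (simp add: a2_def)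
    have xa2o: "c a1 \<in> orbit ?x a2" using orbit.base[of ?x a2] xa2 by simp
    have a2max: "k y \<le> k a2" "k (c a1) \<le> k y" if "y \<in> orbit ?x a2" for y
      using rotational_max[OF rx a2o(2) _ that] rotational_min[OF rx a2o(2) _ that]
        xa2 ca1b \<open>k b < k a2\<close> by auto
    \<comment> \<open>The quotient drops from its cycle maximum \<open>a2\<close>, above
      \<open>b\<close>, to its cycle minimum \<open>c a1\<close>, at most \<open>b\<close>. On the
      way up, \<open>y\<close> is the last point not above \<open>b\<close>.\<close>
    define Y where "Y = {y \<in> orbit ?x a2. k y \<le> k b}"
    have "finite Y" "Y \<noteq> {}"
      using finite_orbit_X[OF x a2o(2)] xa2o ca1b by (auto simp: Y_def)
    then obtain y where y: "y \<in> Y" "\<And>z. z \<in> Y \<Longrightarrow> k z \<le> k y"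
      using ex_max_value by metis
    have yo: "y \<in> orbit ?x a2" "k y \<le> k b" "y \<in> X"
      using y orbit_in_X[OF x a2o(2)] by (auto simp: Y_def)
    have "a2 \<in> orbit ?x y" using orbit_eq[OF x yo(1)] self_in_orbit[OF x] by simp
    then have yup: "k y < k (?x y)"
      using rotational_max[OF rx yo(3), of a2] yo \<open>k b < k a2\<close> by fastforce
    have xyo: "?x y \<in> orbit ?x a2" using orbit.step[OF yo(1)] .
    have xyb: "k b < k (?x y)"
      using y(2)[of "?x y"] xyo yup by (fastforce simp: Y_def)
    \<comment> \<open>\<open>?x y = c z\<close> lies above \<open>b\<close> and \<open>c\<close>
      skips no point, so \<open>z\<close> cannot be below \<open>b\<close>. Thus \<open>u\<close>
      drops from \<open>z\<close> to \<open>y\<close>, which makes \<open>z\<close> the maximum of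
      its \<open>u\<close>-cycle.\<close>
    define z where "z = inv u y"
    have zX: "z \<in> X" using permutes_inv[OF u] yo(3) by (simp add: z_def permutes_in_image)
    have uz: "u z = y" using permutes_inverses[OF u] by (simp add: z_def)
    have xy: "?x y = c z" by (simp add: z_def)
    have cz: "k z < k (c z)"
      using rotational_min[OF rc zX, of y] oc[OF zX] yo(3) yup xy by fastforce
    have "k b \<le> k z"
      using rotational_no_between[OF rc zX, of b] oc[OF zX] bX xyb xy by fastforce
    have "k z < k a2" using a2max(1)[OF xyo] xy cz by simp
    have zmax: "k q \<le> k z" if "q \<in> orbit u z" for q
      using rotational_max[OF ru zX _ that] uz yo(2) \<open>k b \<le> k z\<close> by simp
    have bz: "b \<notin> orbit u z"
    proof
      assume "b \<in> orbit u z"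
      then have "d \<in> orbit u z" using d orbit_eq[OF u] by simp
      then show False using zmax \<open>k z < k a2\<close> \<open>k a2 \<le> k e\<close> lt by fastforce
    qed
    have oyz: "orbit u y = orbit u z" using orbit_eq[OF u] orbit.base[of u z] uz by simp
    have "y \<noteq> b" "z \<noteq> b" using bz oyz self_in_orbit[OF u] by blast+
    then have lt2: "k y < k b" "k b < k z"
      using k_eqD[of y b] k_eqD[of z b] yo bX zX \<open>k b \<le> k z\<close> by fastforce+
    have "k a < k y" using a2max(2)[OF yo(1)] ca1 a1o by simp
    have "b \<in> orbit u y"
    proof (rule less(1)[OF _ yo(3) bX _ d lt2])
      show "k z - k y < k e - k a"
        using \<open>k z < k a2\<close> \<open>k a2 \<le> k e\<close> \<open>k a < k y\<close> lt2 by linarith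
      show "z \<in> orbit u y" using oyz self_in_orbit[OF u] by simp
      show "k z < k d" using \<open>k z < k a2\<close> \<open>k a2 \<le> k e\<close> lt by linarith
    qed
    then show False using bz oyz by simp
  qed
qed

lemma ncyc_full_rotation: "full_rotation c \<Longrightarrow> X \<noteq> {} \<Longrightarrow> ncyc c = 1"
proof -
  assume c: "full_rotation c" "X \<noteq> {}"
  then have "orbit c ` X = {X}" by (auto simp: full_rotation_def)
  then show ?thesis by (simp add: ncyc_def)
qed

text \<open>The geodesic condition forces equality in two instances of
  \<open>ncyc_le_card_wdrop\<close>, because the two sets of weak drops together have
  only \<open>card X + 1\<close> elements.\<close>

lemma
  assumes c: "full_rotation c" and X: "X \<noteq> {}" and u: "u permutes X"
  shows ncyc_quotient_le: "ncyc u + ncyc (c \<circ> inv u) \<le> card X + 1"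
    and geodesic_imp_rotational:
      "ncyc u + ncyc (c \<circ> inv u) = card X + 1 \<Longrightarrow> rotational u"
    and geodesic_imp_noncrossing:
      "ncyc u + ncyc (c \<circ> inv u) = card X + 1 \<Longrightarrow> noncrossing u"
proof -
  have rc: "rotational c" and oc: "\<And>i. i \<in> X \<Longrightarrow> orbit c i = X"
    using c by (auto simp: full_rotation_def)
  note cp = rotational_permutes[OF rc]
  have x: "c \<circ> inv u permutes X" using permutes_compose[OF permutes_inv[OF u] cp] .
  have "card (wdrop c) = 1"
    using rotational_iff[OF cp] rc ncyc_full_rotation[OF c X] by simp
  then have s: "card (wdrop (c \<circ> inv u)) + card (wdrop u) = card X + 1"
    using card_wdrop_quotient[OF rc u] oc u by (simp add: permutes_in_image)
  note le = ncyc_le_card_wdrop[OF u] ncyc_le_card_wdrop[OF x]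
  show "ncyc u + ncyc (c \<circ> inv u) \<le> card X + 1" using s le by simp
  assume e: "ncyc u + ncyc (c \<circ> inv u) = card X + 1"
  show ru: "rotational u" using rotational_iff[OF u] e s le by simp
  have rx: "rotational (c \<circ> inv u)" using rotational_iff[OF x] e s le by simp
  show "noncrossing u"
    unfolding noncrossing_def using geodesic_no_crossing[OF c ru rx] by blast
qed

section \<open>Quotients of nested noncrossing rotations\<close>

text \<open>With \<open>i = inv u m\<close>, the interval is the arc of the \<open>v\<close>-block
  from the successor \<open>v i\<close> of \<open>i\<close> up to \<open>u i = m\<close>. The
  \<open>u\<close>-cycle of \<open>i\<close> has no further point on this arc, so by noncrossing the
  \<open>u\<close>-cycle of any other point \<open>y\<close> of the arc stays inside it. Hence
  \<open>inv u y\<close> lies on the arc strictly before \<open>m\<close>, and one step of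
  \<open>v\<close> does not leave the arc.\<close>

lemma quotient_interval_invariant:
  assumes ru: "rotational u" and rv: "rotational v" and nc: "noncrossing u"
    and uv: "\<And>i. i \<in> X \<Longrightarrow> orbit u i \<subseteq> orbit v i"
    and m: "m \<in> X" "k ((v \<circ> inv u) m) \<le> k m"
    and y: "y \<in> orbit v m" "k ((v \<circ> inv u) m) \<le> k y" "k y \<le> k m"
    and z: "z \<in> orbit (v \<circ> inv u) y"
  shows "z \<in> orbit v m \<and> k ((v \<circ> inv u) m) \<le> k z \<and> k z \<le> k m"
proof -
  let ?x = "v \<circ> inv u"
  note u = rotational_permutes[OF ru] and v = rotational_permutes[OF rv]
  define i where "i = inv u m"
  have ui: "u i = m" using permutes_inverses[OF u] by (simp add: i_def)
  have iX: "i \<in> X" using permutes_inv[OF u] m by (simp add: i_def permutes_in_image)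
  have xm: "?x m = v i" by (simp add: i_def)
  have imu: "orbit u i = orbit u m" using orbit_eq[OF u] orbit.base[of u i] ui by simp
  have mu: "m \<in> orbit u i" using ui orbit.base[of u i] by simp
  have "i \<in> orbit v m" using uv[OF m(1)] imu self_in_orbit[OF u] by blast
  then have imv: "orbit v i = orbit v m" using orbit_eq[OF v] by simp
  have mv: "m \<in> orbit v i" using imv self_in_orbit[OF v] by simp
  have closed: "?x y \<in> orbit v m \<and> k (?x m) \<le> k (?x y) \<and> k (?x y) \<le> k m"
    if y: "y \<in> orbit v m" "k (?x m) \<le> k y" "k y \<le> k m" for y
  proof (cases "y = m")
    case True
    then show ?thesis using m xm imv orbit.base[of v i] by simp
  next
    case False
    have yX: "y \<in> X" using orbit_in_X[OF v m(1) y(1)] .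
    then have ym: "k y < k m" using k_eqD[OF _ yX m(1)] False y(3) by fastforce
    define q where "q = inv u y"
    have uq: "u q = y" using permutes_inverses[OF u] by (simp add: q_def)
    have qX: "q \<in> X" using permutes_inv[OF u] yX by (simp add: q_def permutes_in_image)
    have qo: "orbit u q = orbit u y" using orbit_eq[OF u] orbit.base[of u q] uq by simp
    have yq: "y \<in> orbit u q" "q \<in> orbit u y" using qo self_in_orbit[OF u] by auto
    have "q \<in> orbit v y" using uv[OF yX] yq by blast
    then have qv: "q \<in> orbit v m" "orbit v q = orbit v m" using orbit_eq[OF v] y(1) by auto
    then have mq: "m \<in> orbit v q" using self_in_orbit[OF v] by simp
    have yi: "y \<notin> orbit u m"
    proof
      assume "y \<in> orbit u m"
      then have yo: "y \<in> orbit u i" using imu by simp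
      show False
      proof (cases "k m \<le> k i")
        case True
        then show False using rotational_min[OF ru iX _ yo] ui ym by simp
      next
        case False
        then have "k i < k y"
          using rotational_max[OF rv iX _ mv] y(2) xm by fastforce
        then show False using rotational_no_between[OF ru iX yo] ui ym by simp
      qed
    qed
    then have qi: "q \<notin> orbit u m" using qo orbit_eq[OF u] self_in_orbit[OF u] by metis
    have "q \<noteq> m" "q \<noteq> i" "y \<noteq> i" using qi yi imu self_in_orbit[OF u] by metis+
    then have ne: "k q \<noteq> k m" "k q \<noteq> k i" "k y \<noteq> k i"
      using k_eqD qX m iX yX by metis+
    have im: "i \<in> orbit u m" using imu self_in_orbit[OF u] by metis
    have nc': "b \<in> orbit u a" if "a \<in> X" "b \<in> X" "c \<in> orbit u a" "d \<in> orbit u b"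
        "k a < k b" "k b < k c" "k c < k d" for a b c d
      using nc that unfolding noncrossing_def by blast
    have sw: "b \<in> orbit u a \<Longrightarrow> a \<in> orbit u b" for a b
      using orbit_eq[OF u] self_in_orbit[OF u] by metis
    \<comment> \<open>If \<open>v\<close> drops weakly at \<open>i\<close>, the arc begins at the
      minimum of the \<open>v\<close>-block and only its upper end matters; otherwise the arc is the
      gap from \<open>i\<close> to \<open>m\<close>, with noncrossing used at both ends.\<close>
    have q: "k q < k m \<and> k (?x m) \<le> k q"
    proof (cases "k (v i) \<le> k i")
      case True
      have "k (v i) \<le> k q"
        using rotational_min[OF rv iX True, of q] imv qv by simp
      moreover have "k q \<le> k i"
        using rotational_max[OF rv iX True, of q] imv qv by simp
      moreover have "k m \<le> k i" using rotational_max[OF rv iX True mv] .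
      moreover have "k q < k m"
        using nc'[OF yX m(1) yq(2) im ym] ne yi sw \<open>k q \<le> k i\<close>
        by fastforce
      ultimately show ?thesis using xm by simp
    next
      case False
      have "k (v i) \<le> k q" if "k i < k q"
        using rotational_no_between[OF rv iX, of q] imv qv that by fastforce
      moreover have "k q < k m"
        using nc'[OF iX yX mu yq(2)] False y(2) xm ym ne yi imu
        by fastforce
      moreover have "k i < k q"
        using nc'[OF qX iX yq(1) mu] False y(2) xm ym ne qi imu sw
        by fastforce
      ultimately show ?thesis using xm by simp
    qed
    have "k q < k (v q)" using rotational_max[OF rv qX _ mq] q by fastforce
    moreover have "k (v q) \<le> k m"
      using rotational_no_between[OF rv qX mq] q by fastforce
    ultimately show ?thesis using q qv orbit.step[OF qv(1)] by (simp add: q_def)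
  qed
  show ?thesis using z
  proof induction
    case base then show ?case using closed[OF y] .
  next
    case (step z) then show ?case using closed by blast
  qed
qed

text \<open>The invariant intervals make the quotient rotational, so weak drops count cycles on both
  sides of \<open>card_wdrop_quotient\<close>.\<close>

lemma
  assumes ru: "rotational u" and rv: "rotational v" and nc: "noncrossing u"
    and uv: "\<And>i. i \<in> X \<Longrightarrow> orbit u i \<subseteq> orbit v i"
  shows ncyc_quotient: "ncyc (v \<circ> inv u) + ncyc u = card X + ncyc v"
    and orbit_quotient_subset: "i \<in> X \<Longrightarrow> orbit (v \<circ> inv u) i \<subseteq> orbit v i"
    and noncrossing_quotient: "noncrossing v \<Longrightarrow> noncrossing (v \<circ> inv u)"
proof -
  let ?x = "v \<circ> inv u"
  note u = rotational_permutes[OF ru] and v = rotational_permutes[OF rv]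
  have x: "?x permutes X" using permutes_compose[OF permutes_inv[OF u] v] .
  note inv = quotient_interval_invariant[OF ru rv nc uv]
  have rx: "rotational ?x"
    unfolding rotational_def
  proof (intro conjI ballI x)
    fix i y assume "i \<in> wdrop ?x" "y \<in> orbit ?x i"
    then show "k y \<le> k i"
      using inv[of i i y] self_in_orbit[OF v] by (auto simp: wdrop_def)
  qed
  have "u i \<in> orbit v i" if "i \<in> X" for i using uv[OF that] orbit.base by fast
  then show "ncyc ?x + ncyc u = card X + ncyc v"
    using card_wdrop_quotient[OF rv u] rotational_iff ru rv rx u v x by simp
  show sub: "orbit ?x i \<subseteq> orbit v i" if i: "i \<in> X" for i
  proof
    fix y assume "y \<in> orbit ?x i"
    then show "y \<in> orbit v i"
    proof induction
      case base
      have "inv u i \<in> orbit v i" using uv[OF i] orbit_inv_closed[OF u self_in_orbit[OF u]] by fast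
      then show ?case using orbit.step by fastforce
    next
      case (step y)
      have "y \<in> X" using orbit_in_X[OF v i step(2)] .
      then have "inv u y \<in> orbit v y"
        using uv orbit_inv_closed[OF u self_in_orbit[OF u]] by fast
      then show ?case using orbit.step orbit_eq[OF v step(2)] by fastforce
    qed
  qed
  \<comment> \<open>The minimum \<open>?x m\<close> of the cycle is at most \<open>y\<close>, so
    \<open>b\<close> lies in the invariant interval that ends at \<open>m\<close>, together with its
    whole quotient cycle.\<close>
  have key: "k q \<le> k m"
    if y: "y \<in> X" "m \<in> wdrop ?x" "m \<in> orbit ?x y" "b \<in> orbit v y" "k y \<le> k b" "k b \<le> k m"
      "q \<in> orbit ?x b" for y m b q
  proof -
    have mX: "m \<in> X" "k (?x m) \<le> k m" using y by (auto simp: wdrop_def)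
    have my: "orbit ?x m = orbit ?x y" using orbit_eq[OF x y(3)] .
    have vm: "orbit v m = orbit v y" using orbit_eq[OF v] sub[OF y(1)] y(3) by blast
    have "y \<in> orbit ?x m" using my self_in_orbit[OF x] by simp
    then have "k (?x m) \<le> k y" by (rule rotational_min[OF rx mX])
    then show ?thesis using inv[of m b q] mX y vm by simp
  qed
  show "noncrossing ?x" if "noncrossing v"
    unfolding noncrossing_def
  proof (intro ballI impI)
    fix a b c d assume a: "a \<in> X" and b: "b \<in> X" and c: "c \<in> orbit ?x a" and d: "d \<in> orbit ?x b"
      and lt: "k a < k b" "k b < k c" "k c < k d"
    have bv: "b \<in> orbit v a"
      using that a b c d lt sub[OF a] sub[OF b] unfolding noncrossing_def by blast
    have cv: "c \<in> orbit v b" using orbit_eq[OF v bv] sub[OF a] c by blast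
    have cX: "c \<in> X" using orbit_in_X[OF x a c] .
    obtain m where m: "m \<in> orbit ?x a" "m \<in> wdrop ?x" "\<And>y. y \<in> orbit ?x a \<Longrightarrow> k y \<le> k m"
      using ex_orbit_max[OF x a] by metis
    obtain p where p: "p \<in> orbit ?x b" "p \<in> wdrop ?x" "\<And>y. y \<in> orbit ?x b \<Longrightarrow> k y \<le> k p"
      using ex_orbit_max[OF x b] by metis
    have "k c \<le> k m" "k d \<le> k p" using m p c d by auto
    \<comment> \<open>The two maxima bound each other: \<open>b\<close> lies between
      \<open>a\<close> and \<open>m\<close>, and \<open>c\<close> lies between \<open>b\<close> and
      \<open>p\<close>.\<close>
    then have "k p \<le> k m" using key[OF a m(2,1) bv _ _ p(1)] lt by simp
    moreover have "m \<in> orbit ?x c" using orbit_eq[OF x c] m by simp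
    then have "k m \<le> k p" using key[OF b p(2,1) cv] lt \<open>k d \<le> k p\<close> by simp
    ultimately have "m = p"
      using k_eqD m p by (simp add: wdrop_def)
    then show "b \<in> orbit ?x a" using m p orbit_eq[OF x] self_in_orbit[OF x] by metis
  qed
qed

section \<open>Noncrossing equivalence relations and the noncrossing closure\<close>

text \<open>The relational form is stable under arbitrary intersections, which the closure relies
  on.\<close>

definition noncrossing_rel :: "('a \<times> 'a) set \<Rightarrow> bool" where
  "noncrossing_rel R \<longleftrightarrow> (\<forall>a b c d. (a, c) \<in> R \<longrightarrow> (b, d) \<in> R \<longrightarrow>
     k a < k b \<longrightarrow> k b < k c \<longrightarrow> k c < k d \<longrightarrow> (a, b) \<in> R)"

text \<open>The rotation sends each point to the next higher point of its class, and the top of the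
  class to its bottom.\<close>

lemma ex_rotation_of_classes:
  assumes R: "equiv X R"
  obtains u where "rotational u" "\<And>i. i \<in> X \<Longrightarrow> orbit u i = R `` {i}"
proof -
  define ups where "ups i = {y \<in> R `` {i}. k i < k y}" for i
  have self: "(i, i) \<in> R" if "i \<in> X" for i
    using R that by (auto simp: equiv_def refl_on_def)
  have RX: "a \<in> X \<and> b \<in> X" if "(a, b) \<in> R" for a b
    using equiv_type[OF R] that by auto
  have sw: "(b, a) \<in> R" if "(a, b) \<in> R" for a b
    using R that by (auto simp: equiv_def dest: symD)
  have tr: "(a, c) \<in> R" if "(a, b) \<in> R" "(b, c) \<in> R" for a b c
    using R that by (auto simp: equiv_def dest: transD)
  have "\<exists>x. (i, x) \<in> R \<and> (k i < k x \<longrightarrow> (\<forall>y. (i, y) \<in> R \<longrightarrow> k i < k y \<longrightarrow> k x \<le> k y)) \<and>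
      (k x \<le> k i \<longrightarrow> (\<forall>y. (i, y) \<in> R \<longrightarrow> k x \<le> k y \<and> k y \<le> k i))" if i: "i \<in> X" for i
  proof (cases "ups i = {}")
    case True
    obtain m where "m \<in> R `` {i}" "\<And>y. y \<in> R `` {i} \<Longrightarrow> k m \<le> k y"
      using ex_min_value[of "R `` {i}" k] self[OF i] by blast
    then show ?thesis using True by (intro exI[of _ m]) (auto simp: ups_def not_less)
  next
    case False
    obtain m where "m \<in> ups i" "\<And>y. y \<in> ups i \<Longrightarrow> k m \<le> k y"
      using ex_min_value[OF False, of k] by blast
    then show ?thesis by (intro exI[of _ m]) (auto simp: ups_def)
  qed
  then have "\<exists>f. \<forall>i\<in>X. (i, f i) \<in> R \<and>
      (k i < k (f i) \<longrightarrow> (\<forall>y. (i, y) \<in> R \<longrightarrow> k i < k y \<longrightarrow> k (f i) \<le> k y)) \<and>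
      (k (f i) \<le> k i \<longrightarrow> (\<forall>y. (i, y) \<in> R \<longrightarrow> k (f i) \<le> k y \<and> k y \<le> k i))"
    by (intro bchoice) blast
  then obtain f where f: "\<And>i. i \<in> X \<Longrightarrow> (i, f i) \<in> R"
    "\<And>i y. i \<in> X \<Longrightarrow> k i < k (f i) \<Longrightarrow> (i, y) \<in> R \<Longrightarrow> k i < k y \<Longrightarrow> k (f i) \<le> k y"
    "\<And>i y. i \<in> X \<Longrightarrow> k (f i) \<le> k i \<Longrightarrow> (i, y) \<in> R \<Longrightarrow> k (f i) \<le> k y"
    "\<And>i y. i \<in> X \<Longrightarrow> k (f i) \<le> k i \<Longrightarrow> (i, y) \<in> R \<Longrightarrow> k y \<le> k i"
    by blast
  define u where "u i = (if i \<in> X then f i else i)" for i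
  have inj: "inj_on u X"
  proof (rule inj_onI)
    fix i j assume ij: "i \<in> X" "j \<in> X" "u i = u j"
    then have e: "f i = f j" by (simp add: u_def)
    then have r: "(i, j) \<in> R" "(j, i) \<in> R" using f(1)[OF ij(1)] f(1)[OF ij(2)] sw tr by metis+
    have "k i = k j"
      using f(2)[OF ij(1) _ r(1)] f(2)[OF ij(2) _ r(2)] f(3)[OF ij(1) _ r(1)] f(3)[OF ij(2) _ r(2)]
        f(4)[OF ij(1) _ r(1)] f(4)[OF ij(2) _ r(2)] e
      by (metis leD leI le_antisym)
    then show "i = j" using k_eqD ij by blast
  qed
  have "u ` X \<subseteq> X" using f(1) RX by (auto simp: u_def)
  then have "bij_betw u X X"
    using inj endo_inj_surj[OF finite_X] by (auto simp: bij_betw_def)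
  then have u: "u permutes X" by (rule bij_imp_permutes) (simp add: u_def)
  have sub: "orbit u i \<subseteq> R `` {i}" if i: "i \<in> X" for i
  proof
    fix y assume "y \<in> orbit u i"
    then show "y \<in> R `` {i}"
    proof induction
      case base then show ?case using f(1) i by (simp add: u_def)
    next
      case (step y)
      then have "y \<in> X" using RX by auto
      then show ?case using f(1)[of y] step tr by (auto simp: u_def)
    qed
  qed
  have rot: "rotational u"
    unfolding rotational_def
  proof (intro conjI ballI u)
    fix i y assume "i \<in> wdrop u" "y \<in> orbit u i"
    then show "k y \<le> k i"
      using f(4)[of i y] sub[of i] by (auto simp: wdrop_def u_def)
  qed
  have sup: "R `` {i} \<subseteq> orbit u i" if i: "i \<in> X" for i
  proof
    obtain m where m: "m \<in> orbit u i" "m \<in> wdrop u" "\<And>y. y \<in> orbit u i \<Longrightarrow> k y \<le> k m"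
      using ex_orbit_max[OF u i] by metis
    have mR: "(i, m) \<in> R" using sub[OF i] m by auto
    have mX: "m \<in> X" "k (f m) \<le> k m" using m by (auto simp: wdrop_def u_def)
    fix y assume y: "y \<in> R `` {i}"
    show "y \<in> orbit u i"
    proof (rule ccontr)
      assume ny: "y \<notin> orbit u i"
      have my: "(m, y) \<in> R" using mR y sw tr by blast
      have "k (f m) \<le> k y" "k y \<le> k m" using f(3,4)[OF mX my] by auto
      have fm: "f m \<in> orbit u i" using orbit.step[OF m(1)] mX by (simp add: u_def)
      \<comment> \<open>The orbit contains \<open>f m\<close>, the bottom of the class, so it has
        points below \<open>y\<close>. The highest of them would have to step over \<open>y\<close>,
        although \<open>f\<close> moves to the next higher point of the class.\<close>
      define A where "A = {z \<in> orbit u i. k z < k y}"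
      have "k (f m) \<noteq> k y" using k_eqD[of "f m" y] fm ny orbit_in_X[OF u i fm] y RX by auto
      then have "finite A" "A \<noteq> {}"
        using fm \<open>k (f m) \<le> k y\<close> finite_orbit_X[OF u i] by (auto simp: A_def)
      then obtain z where z: "z \<in> A" "\<And>q. q \<in> A \<Longrightarrow> k q \<le> k z" using ex_max_value by metis
      have zo: "z \<in> orbit u i" "k z < k y" "z \<in> X" "(i, z) \<in> R"
        using z orbit_in_X[OF u i] sub[OF i] by (auto simp: A_def)
      have zy: "(z, y) \<in> R" using zo y sw tr by blast
      have up: "k z < k (f z)" using f(4)[OF zo(3) _ zy] zo by fastforce
      have le: "k (f z) \<le> k y" using f(2)[OF zo(3) up zy zo(2)] .
      have fz: "f z \<in> orbit u i" using orbit.step[OF zo(1)] zo by (simp add: u_def)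
      have "k (f z) \<noteq> k y" using k_eqD[of "f z" y] fz ny orbit_in_X[OF u i fz] y RX by auto
      then have "f z \<in> A" using le fz by (simp add: A_def)
      then show False using z up by fastforce
    qed
  qed
  show ?thesis using that[OF rot] sub sup by blast
qed

definition noncrossing_closure :: "('a \<Rightarrow> 'a) \<Rightarrow> ('a \<times> 'a) set" where
  "noncrossing_closure w =
     \<Inter> {E. equiv X E \<and> noncrossing_rel E \<and> (\<forall>i\<in>X. (i, w i) \<in> E)}"

lemma noncrossing_closure_least:
  "equiv X E \<Longrightarrow> noncrossing_rel E \<Longrightarrow> (\<And>i. i \<in> X \<Longrightarrow> (i, w i) \<in> E) \<Longrightarrow>
    noncrossing_closure w \<subseteq> E"
  by (auto simp: noncrossing_closure_def)

lemma step_in_noncrossing_closure: "i \<in> X \<Longrightarrow> (i, w i) \<in> noncrossing_closure w"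
  by (auto simp: noncrossing_closure_def)

lemma noncrossing_rel_closure: "noncrossing_rel (noncrossing_closure w)"
  unfolding noncrossing_closure_def noncrossing_rel_def by blast

text \<open>As \<open>w\<close> permutes \<open>X\<close>, the full relation on \<open>X\<close>
  belongs to the intersected family, which is therefore nonempty and keeps the closure inside
  \<open>X \<times> X\<close>.\<close>

lemma equiv_noncrossing_closure:
  assumes "w permutes X"
  shows "equiv X (noncrossing_closure w)"
proof -
  have "equiv X (X \<times> X)" by (auto simp: equiv_def refl_on_def sym_def trans_def)
  moreover have "noncrossing_rel (X \<times> X)" by (auto simp: noncrossing_rel_def)
  ultimately have "noncrossing_closure w \<subseteq> X \<times> X"
    using assms by (intro noncrossing_closure_least) (auto simp: permutes_in_image)
  moreover have "(i, i) \<in> noncrossing_closure w" if "i \<in> X" for i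
    using that by (auto simp: noncrossing_closure_def equiv_def refl_on_def)
  moreover have "sym (noncrossing_closure w)"
    by (rule symI) (auto simp: noncrossing_closure_def equiv_def dest: symD)
  moreover have "trans (noncrossing_closure w)"
    by (rule transI) (auto simp: noncrossing_closure_def equiv_def dest: transD)
  ultimately show ?thesis by (auto simp: equiv_def refl_on_def)
qed

lemma noncrossing_closure_fixpoint:
  assumes w: "w permutes X" and i: "w i = i" and ij: "(i, j) \<in> noncrossing_closure w"
  shows "j = i"
proof -
  let ?R = "noncrossing_closure w"
  let ?E = "{(a, b) \<in> ?R. a = i \<longleftrightarrow> b = i}"
  have "equiv X ?E"
  proof -
    have R: "equiv X ?R" using equiv_noncrossing_closure[OF w] .
    have "sym ?E" using R by (auto simp: equiv_def intro!: symI dest: symD)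
    moreover have "trans ?E" using R by (auto simp: equiv_def intro!: transI dest: transD)
    ultimately show ?thesis using R by (auto simp: equiv_def refl_on_def)
  qed
  moreover have "noncrossing_rel ?E"
    unfolding noncrossing_rel_def
  proof (intro allI impI)
    fix a b c d assume *: "(a, c) \<in> ?E" "(b, d) \<in> ?E" "k a < k b" "k b < k c" "k c < k d"
    \<comment> \<open>In \<open>?E\<close>, \<open>a = i\<close> would force \<open>c = i\<close>,
      against \<open>k a < k c\<close>; likewise for \<open>b\<close> and \<open>d\<close>.\<close>
    then have "a \<noteq> i" "b \<noteq> i" by auto
    moreover have "(a, b) \<in> ?R"
      using noncrossing_rel_closure[of w] * unfolding noncrossing_rel_def by blast
    ultimately show "(a, b) \<in> ?E" by simp
  qed
  moreover have "(a, w a) \<in> ?E" if "a \<in> X" for a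
    using step_in_noncrossing_closure[OF that] i permutes_inj[OF w] by (auto dest: injD)
  ultimately have "?R \<subseteq> ?E" by (rule noncrossing_closure_least)
  then show ?thesis using ij by auto
qed

lemma noncrossing_rel_of_orbits:
  assumes u: "u permutes X"
  shows "equiv X {(a, b). a \<in> X \<and> b \<in> orbit u a}"
    and "noncrossing u \<Longrightarrow> noncrossing_rel {(a, b). a \<in> X \<and> b \<in> orbit u a}"
proof -
  show "equiv X {(a, b). a \<in> X \<and> b \<in> orbit u a}"
    using orbit_in_X[OF u] self_in_orbit[OF u] orbit_eq[OF u]
    by (auto simp: equiv_def refl_on_def intro!: symI transI)
qed (auto simp: noncrossing_def noncrossing_rel_def)

lemma noncrossing_of_rel:
  "noncrossing_rel R \<Longrightarrow> (\<And>i. i \<in> X \<Longrightarrow> orbit u i = R `` {i}) \<Longrightarrow> noncrossing u"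
  unfolding noncrossing_def noncrossing_rel_def by blast

end

subsection \<open>The hyperoctahedral group and its reflection length\<close>

text \<open>The rank in the order of \<open>prec\<close>, running from 1 to \<open>2 n\<close> on
  \<open>pm n\<close>. On ranks, negation is the half turn by \<open>n\<close> places and the
  Coxeter element is the cyclic unit step.\<close>

definition key :: "nat \<Rightarrow> int \<Rightarrow> nat" where
  "key n i = nat (if i < 0 then - i else int n + i)"

locale hyperoct =
  fixes n :: nat
begin

lemma finite_pm: "finite (pm n)"
  by (simp add: pm_def)

lemma card_pm: "card (pm n) = 2 * n"
proof -
  have "card (pm n) = card {- int n .. int n} - card {0::int}"
    unfolding pm_def by (rule card_Diff_subset) auto
  then show ?thesis by simp
qed

lemma inj_on_key: "inj_on (key n) (pm n)"
  by (rule inj_onI) (auto simp: key_def pm_def split: if_splits)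

end

sublocale hyperoct \<subseteq> ranked_set "pm n" "key n"
  by unfold_locales (fact finite_pm inj_on_key)+

context hyperoct
begin

lemma neg_pm [simp]: "- i \<in> pm n \<longleftrightarrow> i \<in> pm n"
  by (auto simp: pm_def)

lemma prec_iff_key: "i \<in> pm n \<Longrightarrow> j \<in> pm n \<Longrightarrow> prec i j \<longleftrightarrow> key n i < key n j"
  by (auto simp: pm_def prec_def key_def sgn_if)

lemma key_neg:
  "i \<in> pm n \<Longrightarrow> (i < 0 \<and> key n i \<le> n \<and> key n (- i) = key n i + n) \<or>
    (0 < i \<and> n < key n i \<and> key n i = key n (- i) + n)"
  by (auto simp: pm_def key_def)

lemma H_permutes: "w \<in> hyperoctahedral n \<Longrightarrow> w permutes pm n"
  by (simp add: hyperoctahedral_def)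

lemma H_in_pm [simp]: "w \<in> hyperoctahedral n \<Longrightarrow> w i \<in> pm n \<longleftrightarrow> i \<in> pm n"
  by (rule permutes_in_image[OF H_permutes])

lemma H_neg: "w \<in> hyperoctahedral n \<Longrightarrow> w (- i) = - w i"
  by (cases "i \<in> pm n") (auto simp: hyperoctahedral_def permutes_def)

lemma id_in_H: "id \<in> hyperoctahedral n"
  by (simp add: hyperoctahedral_def permutes_id)

lemma comp_in_H: "v \<in> hyperoctahedral n \<Longrightarrow> w \<in> hyperoctahedral n \<Longrightarrow> v \<circ> w \<in> hyperoctahedral n"
  by (simp add: hyperoctahedral_def permutes_compose permutes_in_image)

lemma inv_in_H: "w \<in> hyperoctahedral n \<Longrightarrow> inv w \<in> hyperoctahedral n"
proof -
  assume w: "w \<in> hyperoctahedral n"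
  note p = H_permutes[OF w]
  have "inv w (- i) = - inv w i" for i
    by (metis H_neg[OF w] p permutes_inverses)
  then show ?thesis using permutes_inv[OF p] by (simp add: hyperoctahedral_def)
qed

lemma orbit_neg:
  assumes w: "w \<in> hyperoctahedral n"
  shows "orbit w (- i) = uminus ` orbit w i"
proof -
  have sub: "- y \<in> orbit w (- i)" if "y \<in> orbit w i" for y i
    using that
  proof induction
    case base
    then show ?case using orbit.base[of w "- i"] H_neg[OF w] by simp
  next
    case (step y)
    then show ?case using orbit.step[OF step(2)] H_neg[OF w] by simp
  qed
  show ?thesis
    using sub[of _ i] sub[of _ "- i"] by (auto simp: image_iff) (metis minus_minus)
qed

section \<open>Balanced orbits and opposite pairs of orbits\<close>

definition bal_orbits :: "(int \<Rightarrow> int) \<Rightarrow> int set set" where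
  "bal_orbits w = {Q \<in> orbit w ` pm n. uminus ` Q = Q}"

text \<open>The condition selects one orbit from each pair of distinct orbits \<open>Q\<close> and \<open>-Q\<close>.\<close>

definition pos_orbits :: "(int \<Rightarrow> int) \<Rightarrow> int set set" where
  "pos_orbits w = {Q \<in> orbit w ` pm n. - Min Q < Max Q}"

lemma balanced_iff:
  assumes w: "w \<in> hyperoctahedral n"
  shows "uminus ` orbit w i = orbit w i \<longleftrightarrow> - i \<in> orbit w i"
proof
  assume "uminus ` orbit w i = orbit w i"
  then show "- i \<in> orbit w i"
    using self_in_orbit[OF H_permutes[OF w], of i] by blast
next
  assume "- i \<in> orbit w i"
  then show "uminus ` orbit w i = orbit w i"
    using orbit_eq[OF H_permutes[OF w], of "- i" i] orbit_neg[OF w, of i] by simp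
qed

lemma Min_Max_neg_orbit:
  assumes w: "w \<in> hyperoctahedral n" and i: "i \<in> pm n"
  shows "Min (orbit w (- i)) = - Max (orbit w i)" "Max (orbit w (- i)) = - Min (orbit w i)"
proof -
  have f: "finite (orbit w i)" "orbit w i \<noteq> {}"
    using finite_orbit_X[OF H_permutes[OF w] i] by (auto simp: orbit_nonempty)
  have f': "finite (orbit w (- i))" "orbit w (- i) \<noteq> {}"
    using finite_orbit_X[OF H_permutes[OF w], of "- i"] i by (auto simp: orbit_nonempty)
  show "Min (orbit w (- i)) = - Max (orbit w i)"
    using minus_Max_eq_Min[OF f] orbit_neg[OF w, of i] by simp
  show "Max (orbit w (- i)) = - Min (orbit w i)"
    using minus_Max_eq_Min[OF f'] orbit_neg[OF w, of "- i"] by simp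
qed

text \<open>Negation exchanges \<open>Min\<close> and \<open>Max\<close> up to sign and so reverses
  the selecting inequality. In the remaining case of equality, the orbit contains both its maximum
  and the negative of it, which makes it balanced.\<close>

lemma orbit_trichotomy:
  assumes w: "w \<in> hyperoctahedral n" and i: "i \<in> pm n"
  shows "orbit w i \<in> pos_orbits w \<or> orbit w (- i) \<in> pos_orbits w \<or> - i \<in> orbit w i"
    and "orbit w i \<in> pos_orbits w \<Longrightarrow> orbit w (- i) \<notin> pos_orbits w"
    and "orbit w i \<in> pos_orbits w \<Longrightarrow> - i \<notin> orbit w i"
proof -
  note p = H_permutes[OF w]
  note mm = Min_Max_neg_orbit[OF w i]
  have f: "finite (orbit w i)" "orbit w i \<noteq> {}"
    using finite_orbit_X[OF p i] by (auto simp: orbit_nonempty)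
  have pos: "orbit w i \<in> pos_orbits w \<longleftrightarrow> - Min (orbit w i) < Max (orbit w i)"
    "orbit w (- i) \<in> pos_orbits w \<longleftrightarrow> Max (orbit w i) < - Min (orbit w i)"
    using i mm by (auto simp: pos_orbits_def)
  show "orbit w i \<in> pos_orbits w \<Longrightarrow> orbit w (- i) \<notin> pos_orbits w" using pos by simp
  show "orbit w i \<in> pos_orbits w \<Longrightarrow> - i \<notin> orbit w i"
    using pos mm orbit_eq[OF p, of "- i" i] by auto
  have "- i \<in> orbit w i" if "- Min (orbit w i) = Max (orbit w i)"
  proof -
    let ?m = "Max (orbit w i)"
    have m: "?m \<in> orbit w i" using f by simp
    have "- ?m \<in> orbit w i" using Min_in[OF f] that by (metis minus_minus)
    then have "- ?m \<in> orbit w ?m" using orbit_eq[OF p m] by simp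
    then have "uminus ` orbit w ?m = orbit w ?m" using balanced_iff[OF w] by simp
    then show ?thesis using orbit_eq[OF p m] balanced_iff[OF w] by simp
  qed
  then show "orbit w i \<in> pos_orbits w \<or> orbit w (- i) \<in> pos_orbits w \<or> - i \<in> orbit w i"
    using pos by linarith
qed

lemma ncyc_eq:
  assumes w: "w \<in> hyperoctahedral n"
  shows "ncyc w = 2 * card (pos_orbits w) + card (bal_orbits w)"
proof -
  note p = H_permutes[OF w]
  let ?neg = "(`) uminus ` pos_orbits w"
  have fin: "finite (pos_orbits w)" "finite (bal_orbits w)"
    by (simp_all add: pos_orbits_def bal_orbits_def finite_pm)
  have posI: "\<exists>i\<in>pm n. Q = orbit w i" if "Q \<in> pos_orbits w" for Q
    using that by (auto simp: pos_orbits_def)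
  have 1: "orbit w ` pm n = pos_orbits w \<union> ?neg \<union> bal_orbits w"
  proof (intro equalityI subsetI)
    fix Q assume "Q \<in> orbit w ` pm n"
    then obtain i where i: "i \<in> pm n" "Q = orbit w i" by auto
    have "Q = uminus ` orbit w (- i)" using orbit_neg[OF w, of "- i"] i by simp
    then show "Q \<in> pos_orbits w \<union> ?neg \<union> bal_orbits w"
      using orbit_trichotomy(1)[OF w i(1)] i balanced_iff[OF w, of i]
      by (auto simp: bal_orbits_def)
  next
    fix Q assume "Q \<in> pos_orbits w \<union> ?neg \<union> bal_orbits w"
    moreover have "uminus ` orbit w i \<in> orbit w ` pm n" if "i \<in> pm n" for i
      using that by (simp flip: orbit_neg[OF w])
    ultimately show "Q \<in> orbit w ` pm n"
      by (auto simp: bal_orbits_def pos_orbits_def)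
  qed
  have 2: "pos_orbits w \<inter> ?neg = {}"
  proof -
    have "uminus ` Q \<notin> pos_orbits w" if "Q \<in> pos_orbits w" for Q
      using posI[OF that] orbit_trichotomy(2)[OF w] orbit_neg[OF w] that by metis
    then show ?thesis by auto
  qed
  have 3: "(pos_orbits w \<union> ?neg) \<inter> bal_orbits w = {}"
  proof -
    have ne: "uminus ` Q \<noteq> Q" if "Q \<in> pos_orbits w" for Q
      using posI[OF that] orbit_trichotomy(3)[OF w] balanced_iff[OF w] that by metis
    have "Q \<notin> bal_orbits w" if Q: "Q \<in> pos_orbits w \<union> ?neg" for Q
    proof (cases "Q \<in> pos_orbits w")
      case True
      then show ?thesis using ne by (simp add: bal_orbits_def)
    next
      case False
      then obtain P where P: "P \<in> pos_orbits w" "Q = uminus ` P" using Q by auto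
      have "uminus ` Q = P" using P by (simp add: image_comp)
      then show ?thesis using ne[OF P(1)] P(2) by (auto simp: bal_orbits_def)
    qed
    then show ?thesis by auto
  qed
  have 4: "card ?neg = card (pos_orbits w)"
    by (intro card_image inj_onI) (simp add: inj_image_eq_iff)
  have "ncyc w = card (pos_orbits w \<union> ?neg) + card (bal_orbits w)"
    unfolding ncyc_def 1 using fin 3 by (intro card_Un_disjoint) auto
  also have "card (pos_orbits w \<union> ?neg) = card (pos_orbits w) + card ?neg"
    using fin 2 by (intro card_Un_disjoint) auto
  finally show ?thesis using 4 by simp
qed

text \<open>Odd \<open>w\<close>-invariant functions with values in the field with three elements. They form
  a vector space of dimension \<open>card (pos_orbits w)\<close>, the dimension of the fixed space
  of \<open>w\<close>, and dimensions can be compared by counting elements.\<close>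

definition inv_funs :: "(int \<Rightarrow> int) \<Rightarrow> (int \<Rightarrow> int) set" where
  "inv_funs w = {f. (\<forall>i. i \<notin> pm n \<longrightarrow> f i = 0) \<and>
     (\<forall>i\<in>pm n. f i \<in> {0, 1, 2} \<and> f (- i) = (- f i) mod 3 \<and> f (w i) = f i)}"

lemma inv_funs_orbit:
  assumes w: "w \<in> hyperoctahedral n" and f: "f \<in> inv_funs w" and i: "i \<in> pm n"
    and y: "y \<in> orbit w i"
  shows "f y = f i"
  using y
proof induction
  case base then show ?case using f i by (simp add: inv_funs_def)
next
  case (step y)
  then show ?case using f orbit_in_X[OF H_permutes[OF w] i step(1)] by (simp add: inv_funs_def)
qed

text \<open>Values on the selected orbits are free and those on the opposite orbits follow by
  oddness. On a balanced orbit the value equals its own negative, hence vanishes; this needs 2 to be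
  invertible, and 3 is the smallest modulus that works.\<close>

lemma card_inv_funs:
  assumes w: "w \<in> hyperoctahedral n"
  shows "card (inv_funs w) = 3 ^ card (pos_orbits w)"
proof -
  note p = H_permutes[OF w]
  let ?P = "PiE (pos_orbits w) (\<lambda>_. {0, 1, 2 :: int})"
  define F where "F g i = (if i \<notin> pm n then 0 else if orbit w i \<in> pos_orbits w then g (orbit w i)
      else if orbit w (- i) \<in> pos_orbits w then (- g (orbit w (- i))) mod 3 else 0 :: int)"
    for g i
  have "bij_betw F ?P (inv_funs w)"
    unfolding bij_betw_def
  proof (intro conjI equalityI subsetI)
    show "inj_on F ?P"
    proof (rule inj_onI)
      fix g g' assume g: "g \<in> ?P" "g' \<in> ?P" "F g = F g'"
      have "g Q = g' Q" if Q: "Q \<in> pos_orbits w" for Q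
      proof -
        obtain i where "i \<in> pm n" "Q = orbit w i" using Q by (auto simp: pos_orbits_def)
        then show ?thesis using fun_cong[OF g(3), of i] Q by (simp add: F_def)
      qed
      then show "g = g'" using PiE_ext[OF g(1,2)] by blast
    qed
  next
    fix f assume "f \<in> F ` ?P"
    then obtain g where g: "g \<in> ?P" "f = F g" by auto
    have gv: "g Q \<in> {0, 1, 2}" if "Q \<in> pos_orbits w" for Q using g that by auto
    show "f \<in> inv_funs w"
      unfolding inv_funs_def
    proof (intro CollectI conjI ballI allI impI)
      fix i assume "i \<notin> pm n" then show "f i = 0" using g by (simp add: F_def)
    next
      fix i assume i: "i \<in> pm n"
      have "orbit w (w i) = orbit w i" "orbit w (- w i) = orbit w (- i)"
        using orbit_eq[OF p orbit.base] orbit_neg[OF w] by simp_all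
      then show "f (w i) = f i" using w by (simp add: g F_def)
      show "f i \<in> {0, 1, 2}"
      proof (cases "orbit w i \<in> pos_orbits w")
        case True
        then show ?thesis using i gv[OF True] by (simp add: g F_def)
      next
        case False
        then show ?thesis using gv[of "orbit w (- i)"] i by (auto simp: g F_def)
      qed
      show "f (- i) = (- f i) mod 3"
      proof (cases "orbit w i \<in> pos_orbits w")
        case True
        then show ?thesis using i orbit_trichotomy(2)[OF w i] by (simp add: g F_def)
      next
        case False
        then show ?thesis using gv[of "orbit w (- i)"] i by (auto simp: g F_def)
      qed
    qed
  next
    fix f assume f: "f \<in> inv_funs w"
    \<comment> \<open>The chosen representative is immaterial, since \<open>f\<close> is constant on
      orbits.\<close>
    define g where "g = restrict (\<lambda>Q. f (SOME i. i \<in> Q)) (pos_orbits w)"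
    have gQ: "g (orbit w i) = f i" if "i \<in> pm n" "orbit w i \<in> pos_orbits w" for i
    proof -
      have "(SOME y. y \<in> orbit w i) \<in> orbit w i"
        using self_in_orbit[OF p] by (rule someI)
      then show ?thesis using inv_funs_orbit[OF w f that(1)] that by (simp add: g_def)
    qed
    have "g \<in> ?P"
    proof (rule PiE_I)
      fix Q assume "Q \<in> pos_orbits w"
      then obtain i where "i \<in> pm n" "Q = orbit w i" "orbit w i \<in> pos_orbits w"
        by (auto simp: pos_orbits_def)
      then show "g Q \<in> {0, 1, 2}" using gQ[of i] f by (auto simp: inv_funs_def)
    qed (simp add: g_def)
    moreover have "f = F g"
    proof
      fix i
      show "f i = F g i"
      proof (cases "i \<in> pm n")
        case False then show ?thesis using f by (simp add: F_def inv_funs_def)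
      next
        case True
        then have v: "f i \<in> {0, 1, 2}" "f (- i) = (- f i) mod 3" using f by (auto simp: inv_funs_def)
        consider "orbit w i \<in> pos_orbits w"
          | "orbit w i \<notin> pos_orbits w" "orbit w (- i) \<in> pos_orbits w"
          | "orbit w i \<notin> pos_orbits w" "orbit w (- i) \<notin> pos_orbits w" "- i \<in> orbit w i"
          using orbit_trichotomy(1)[OF w True] by blast
        then show ?thesis
        proof cases
          case 1 then show ?thesis using gQ True by (simp add: F_def)
        next
          case 2 then show ?thesis using gQ[of "- i"] True v by (auto simp: F_def)
        next
          case 3
          then have "f (- i) = f i" using inv_funs_orbit[OF w f True] by simp
          then have "f i = 0" using v by auto
          then show ?thesis using 3 by (simp add: F_def)
        qed
      qed
    qed
    ultimately show "f \<in> F ` ?P" by blast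
  qed
  then have "card (inv_funs w) = card ?P" using bij_betw_same_card by metis
  also have "\<dots> = 3 ^ card (pos_orbits w)"
    by (simp add: card_PiE pos_orbits_def finite_pm numeral_eq_Suc)
  finally show ?thesis .
qed

lemma finite_inv_funs: "w \<in> hyperoctahedral n \<Longrightarrow> finite (inv_funs w)"
  by (rule card_ge_0_finite) (simp add: card_inv_funs)

section \<open>Reflections and Carter's formula for the reflection length\<close>

text \<open>One formula for both kinds of reflections: for \<open>b = - a\<close> the last two tests
  merely repeat the first two.\<close>

definition srefl :: "int \<Rightarrow> int \<Rightarrow> int \<Rightarrow> int" where
  "srefl a b i = (if i = a then b else if i = b then a else if i = - a then - b
     else if i = - b then - a else i)"

lemma reflections_eq: "reflections n = {srefl a b | a b. a \<in> pm n \<and> b \<in> pm n \<and> a \<noteq> b}"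
proof -
  have paired: "transpose a b \<circ> transpose (- a) (- b) = srefl a b"
    if "a \<in> pm n" "b \<in> pm n" "a \<noteq> b" "a \<noteq> - b" for a b
    using that by (auto simp: fun_eq_iff srefl_def transpose_def pm_def)
  have single: "transpose a (- a) = srefl a (- a)" if "a \<in> pm n" for a
    using that by (auto simp: fun_eq_iff srefl_def transpose_def pm_def)
  have nz: "a \<noteq> - a" if "a \<in> pm n" for a using that by (auto simp: pm_def)
  show ?thesis
  proof (intro equalityI subsetI)
    fix t assume "t \<in> reflections n"
    then consider a b where "t = transpose a b \<circ> transpose (- a) (- b)" "a \<in> pm n" "b \<in> pm n"
        "a \<noteq> b" "a \<noteq> - b"
      | a where "t = transpose a (- a)" "a \<in> pm n"
      unfolding reflections_def by blast
    then show "t \<in> {srefl a b | a b. a \<in> pm n \<and> b \<in> pm n \<and> a \<noteq> b}"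
    proof cases
      case 1 then show ?thesis using paired by blast
    next
      case 2 then show ?thesis using single nz neg_pm by blast
    qed
  next
    fix t assume "t \<in> {srefl a b | a b. a \<in> pm n \<and> b \<in> pm n \<and> a \<noteq> b}"
    then obtain a b where t: "t = srefl a b" "a \<in> pm n" "b \<in> pm n" "a \<noteq> b" by blast
    show "t \<in> reflections n"
    proof (cases "a = - b")
      case True
      then have "t = transpose a (- a)" using single[OF t(2)] t by simp
      then show ?thesis using t(2) unfolding reflections_def by blast
    next
      case False
      then have "t = transpose a b \<circ> transpose (- a) (- b)" using paired t by simp
      then show ?thesis using t False unfolding reflections_def by blast
    qed
  qed
qed

lemma reflectionE:
  assumes "t \<in> reflections n"
  obtains a b where "t = srefl a b" "a \<in> pm n" "b \<in> pm n" "a \<noteq> b"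
  using assms unfolding reflections_eq by blast

lemma srefl_srefl: "a \<in> pm n \<Longrightarrow> b \<in> pm n \<Longrightarrow> srefl a b (srefl a b i) = i"
  by (auto simp: srefl_def pm_def)

lemma srefl_in_H:
  assumes a: "a \<in> pm n" "b \<in> pm n"
  shows "srefl a b \<in> hyperoctahedral n"
proof -
  have "srefl a b permutes pm n"
    unfolding permutes_def
  proof (intro conjI allI impI)
    fix i show "i \<notin> pm n \<Longrightarrow> srefl a b i = i" using a by (auto simp: srefl_def)
    show "\<exists>!x. srefl a b x = i" using srefl_srefl[OF a] by metis
  qed
  moreover have "srefl a b (- i) = - srefl a b i" for i using a by (auto simp: srefl_def pm_def)
  ultimately show ?thesis by (simp add: hyperoctahedral_def)
qed

lemma reflection_in_H: "t \<in> reflections n \<Longrightarrow> t \<in> hyperoctahedral n"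
  using srefl_in_H by (auto elim!: reflectionE)

lemma reflection_comp_self: "t \<in> reflections n \<Longrightarrow> t \<circ> t = id"
  using srefl_srefl by (auto elim!: reflectionE simp: fun_eq_iff)

lemma reflection_inv: "t \<in> reflections n \<Longrightarrow> inv t = t"
  using reflection_comp_self inv_unique_comp by blast

lemma inv_funs_subset_id: "inv_funs w \<subseteq> inv_funs id"
  by (auto simp: inv_funs_def)

lemma inv_funs_refl:
  assumes "a \<in> pm n" "b \<in> pm n" "f \<in> inv_funs id"
  shows "f \<in> inv_funs (srefl a b) \<longleftrightarrow> f a = f b"
proof
  assume "f \<in> inv_funs (srefl a b)"
  then have "f (srefl a b a) = f a" using assms(1) by (simp add: inv_funs_def)
  then show "f a = f b" by (simp add: srefl_def)
next
  assume e: "f a = f b"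
  have "f (- a) = (- f a) mod 3" "f (- b) = (- f b) mod 3" using assms by (simp_all add: inv_funs_def)
  then have "f (- a) = f (- b)" using e by simp
  then have "f (srefl a b i) = f i" for i using e by (simp add: srefl_def)
  then show "f \<in> inv_funs (srefl a b)" using assms(3) by (simp add: inv_funs_def)
qed

text \<open>The fibres of \<open>f \<mapsto> f a - f b\<close> on \<open>inv_funs w\<close> are translates of subsets of its kernel.\<close>

lemma card_inv_funs_le:
  assumes w: "w \<in> hyperoctahedral n" and t: "t \<in> reflections n"
  shows "card (inv_funs w) \<le> 3 * card (inv_funs w \<inter> inv_funs t)"
proof -
  obtain a b where ab: "t = srefl a b" "a \<in> pm n" "b \<in> pm n" using t by (rule reflectionE)
  let ?K = "inv_funs w \<inter> inv_funs t"
  have finK: "finite ?K" using finite_inv_funs[OF w] by simp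
  define G where "G r = {f \<in> inv_funs w. (f a - f b) mod 3 = r}" for r
  have le: "card (G r) \<le> card ?K" for r
  proof (cases "G r = {}")
    case False
    then obtain h where h: "h \<in> G r" by blast
    let ?d = "\<lambda>f i. (f i - h i) mod 3"
    have hv: "h i \<in> {0, 1, 2}" "i \<in> pm n \<Longrightarrow> h (- i) = (- h i) mod 3" "i \<in> pm n \<Longrightarrow> h (w i) = h i" for i
      using h by (cases "i \<in> pm n"; auto simp: G_def inv_funs_def)+
    have "inj_on ?d (G r)"
    proof (rule inj_onI)
      fix f g assume fg: "f \<in> G r" "g \<in> G r" "?d f = ?d g"
      have "f i \<in> {0, 1, 2}" "g i \<in> {0, 1, 2}" for i
        using fg by (cases "i \<in> pm n"; auto simp: G_def inv_funs_def)+
      then have "f i = g i" for i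
        using hv(1)[of i] fun_cong[OF fg(3), of i]
        by (smt (verit) insert_iff empty_iff mod_pos_pos_trivial minus_mod_self2 mod_add_self2)
      then show "f = g" by blast
    qed
    moreover have "?d ` G r \<subseteq> ?K"
    proof
      fix g assume "g \<in> ?d ` G r"
      then obtain f where f: "f \<in> G r" "g = ?d f" by blast
      have gw: "g \<in> inv_funs w"
        unfolding inv_funs_def
      proof (intro CollectI conjI allI ballI impI)
        fix i assume "i \<notin> pm n" then show "g i = 0"
          using f h by (simp add: G_def inv_funs_def)
      next
        fix i assume i: "i \<in> pm n"
        have "g i \<in> {0..<3}" using f by simp
        then show "g i \<in> {0, 1, 2}" by auto
        show "g (w i) = g i" using f h i by (simp add: G_def inv_funs_def)
        have "f (- i) = (- f i) mod 3" using f i by (simp add: G_def inv_funs_def)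
        then have "g (- i) = ((- f i) mod 3 - (- h i) mod 3) mod 3" using hv(2)[OF i] f by simp
        also have "\<dots> = (- (f i - h i)) mod 3" by (simp add: mod_diff_eq)
        also have "\<dots> = (- g i) mod 3" using f by (simp add: mod_minus_eq)
        finally show "g (- i) = (- g i) mod 3" .
      qed
      have "(f a - f b) mod 3 = (h a - h b) mod 3" using f h by (simp add: G_def)
      then have "(f a - h a) mod 3 = (f b - h b) mod 3"
        by (simp add: mod_eq_dvd_iff algebra_simps)
      then have "g a = g b" using f by simp
      then show "g \<in> ?K" using gw inv_funs_refl[OF ab(2,3), of g] inv_funs_subset_id ab(1) by blast
    qed
    ultimately show ?thesis using finK by (rule card_inj_on_le)
  qed simp
  have "(f a - f b) mod 3 \<in> {0, 1, 2}" for f :: "int \<Rightarrow> int"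
    using pos_mod_bound[of 3 "f a - f b"] pos_mod_sign[of 3 "f a - f b"] by auto
  then have "inv_funs w \<subseteq> G 0 \<union> G 1 \<union> G 2" by (auto simp: G_def)
  moreover have "finite (G r)" for r using finite_inv_funs[OF w] by (simp add: G_def)
  ultimately have "card (inv_funs w) \<le> card (G 0 \<union> G 1 \<union> G 2)" by (intro card_mono) auto
  also have "\<dots> \<le> card (G 0) + card (G 1) + card (G 2)"
    using card_Un_le[of "G 0 \<union> G 1" "G 2"] card_Un_le[of "G 0" "G 1"] by linarith
  also have "\<dots> \<le> 3 * card ?K" using le[of 0] le[of 1] le[of 2] by linarith
  finally show ?thesis .
qed

abbreviation npos :: "(int \<Rightarrow> int) \<Rightarrow> nat" where
  "npos w \<equiv> card (pos_orbits w)"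

text \<open>A reflection hyperplane lowers the dimension of a space of functions by at most one; the
  count of elements is turned back into dimensions by comparing exponents of 3.\<close>

lemma npos_le_if:
  assumes w: "w \<in> hyperoctahedral n" and t: "t \<in> reflections n" and v: "v \<in> hyperoctahedral n"
    and sub: "inv_funs w \<inter> inv_funs t \<subseteq> inv_funs v"
  shows "npos w \<le> npos v + 1"
proof -
  have "(3::nat) ^ npos w \<le> 3 * card (inv_funs w \<inter> inv_funs t)"
    using card_inv_funs_le[OF w t] card_inv_funs[OF w] by simp
  also have "\<dots> \<le> 3 ^ (npos v + 1)"
    using card_mono[OF finite_inv_funs[OF v] sub] card_inv_funs[OF v] by simp
  finally show ?thesis by (rule power_le_imp_le_exp[rotated]) simp
qed

lemma inv_funs_comp:
  assumes "v \<in> hyperoctahedral n" "w \<in> hyperoctahedral n"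
  shows "inv_funs v \<inter> inv_funs w \<subseteq> inv_funs (v \<circ> w)"
  using assms by (auto simp: inv_funs_def)

lemma npos_comp_reflection:
  assumes w: "w \<in> hyperoctahedral n" and t: "t \<in> reflections n"
  shows "npos w \<le> npos (w \<circ> t) + 1" "npos w \<le> npos (t \<circ> w) + 1" "npos (w \<circ> t) \<le> npos w + 1"
proof -
  note tH = reflection_in_H[OF t]
  show "npos w \<le> npos (w \<circ> t) + 1"
    using npos_le_if[OF w t comp_in_H[OF w tH]] inv_funs_comp[OF w tH] by blast
  show "npos w \<le> npos (t \<circ> w) + 1"
    using npos_le_if[OF w t comp_in_H[OF tH w]] inv_funs_comp[OF tH w] by blast
  have "w \<circ> t \<circ> t = w" using reflection_comp_self[OF t] by (simp add: comp_assoc)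
  then show "npos (w \<circ> t) \<le> npos w + 1"
    using npos_le_if[OF comp_in_H[OF w tH] t w] inv_funs_comp[OF comp_in_H[OF w tH] tH] by simp
qed

lemma npos_id: "npos id = n"
proof -
  have o: "orbit id i = {i}" for i :: int using orbit_eq_singleton_iff[of id i] by simp
  have "bal_orbits id = {}"
    unfolding bal_orbits_def o by (auto simp: pm_def)
  moreover have "ncyc id = 2 * n"
    unfolding ncyc_def o using card_pm by (simp add: card_image)
  ultimately show ?thesis using ncyc_eq[OF id_in_H] by simp
qed

lemma npos_le: "w \<in> hyperoctahedral n \<Longrightarrow> npos w \<le> n"
proof -
  assume w: "w \<in> hyperoctahedral n"
  have "(3::nat) ^ npos w \<le> 3 ^ n"
    using card_mono[OF finite_inv_funs[OF id_in_H] inv_funs_subset_id, of w] npos_id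
      card_inv_funs[OF w] card_inv_funs[OF id_in_H] by simp
  then show ?thesis by (rule power_le_imp_le_exp[rotated]) simp
qed

text \<open>The odd indicator of an unbalanced orbit, with 2 standing for \<open>-1\<close>. These
  functions separate an unbalanced orbit from every other orbit.\<close>

lemma orbit_indicator:
  assumes w: "w \<in> hyperoctahedral n" and i: "i \<in> pm n" and nb: "- i \<notin> orbit w i"
  shows "(\<lambda>y. if y \<in> orbit w i then 1 else if - y \<in> orbit w i then 2 else 0) \<in> inv_funs w"
proof -
  note p = H_permutes[OF w]
  have dis: "\<not> (y \<in> orbit w i \<and> - y \<in> orbit w i)" for y
  proof
    assume y: "y \<in> orbit w i \<and> - y \<in> orbit w i"
    then have "- y \<in> orbit w y" using orbit_eq[OF p] by blast
    then have "uminus ` orbit w y = orbit w y" using balanced_iff[OF w] by simp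
    moreover have "orbit w y = orbit w i" using y orbit_eq[OF p] by blast
    ultimately show False using nb balanced_iff[OF w] by simp
  qed
  have out: "y \<in> pm n" if "y \<in> orbit w i" for y using orbit_in_X[OF p i that] .
  have st: "w y \<in> orbit w i \<longleftrightarrow> y \<in> orbit w i" for y
    using orbit.step[of y w i] orbit_inv_closed[OF p, of "w y" i] permutes_inverses(2)[OF p] by auto
  have st': "- w y \<in> orbit w i \<longleftrightarrow> - y \<in> orbit w i" for y
    using st[of "- y"] H_neg[OF w] by simp
  show ?thesis
    using dis out[of "- _"] by (auto simp: inv_funs_def st st' dest: out)
qed

text \<open>Functions invariant under \<open>w\<close> agree at \<open>i\<close> and
  \<open>w i\<close>, so they stay invariant under the product. The product also fixes
  \<open>w i\<close>, whose odd indicator is a new invariant function because \<open>w\<close> does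
  not fix \<open>w i\<close>; the dimension grows, and by at most one.\<close>

lemma npos_step:
  assumes w: "w \<in> hyperoctahedral n" and i: "i \<in> pm n" and ne: "w i \<noteq> i"
  shows "npos (w \<circ> srefl i (w i)) = npos w + 1"
proof -
  let ?t = "srefl i (w i)" and ?j = "w i"
  have j: "?j \<in> pm n" using w i by simp
  have t: "?t \<in> reflections n" using i j ne unfolding reflections_eq by (intro CollectI exI) auto
  note tH = reflection_in_H[OF t]
  note v = comp_in_H[OF w tH]
  have vj: "(w \<circ> ?t) ?j = ?j" using ne by (simp add: srefl_def)
  have "inv_funs w \<subseteq> inv_funs ?t"
  proof
    fix f assume f: "f \<in> inv_funs w"
    then have "f i = f ?j" using i by (simp add: inv_funs_def)
    then show "f \<in> inv_funs ?t" using inv_funs_refl[OF i j] f inv_funs_subset_id by blast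
  qed
  then have sub: "inv_funs w \<subseteq> inv_funs (w \<circ> ?t)" using inv_funs_comp[OF w tH] by blast
  have o: "orbit (w \<circ> ?t) ?j = {?j}" using vj orbit_eq_singleton_iff by metis
  let ?f = "\<lambda>y. if y \<in> orbit (w \<circ> ?t) ?j then 1 else if - y \<in> orbit (w \<circ> ?t) ?j then 2 else 0 :: int"
  have "?f \<in> inv_funs (w \<circ> ?t)"
    by (rule orbit_indicator[OF v j]) (use j in \<open>auto simp: o pm_def\<close>)
  moreover have "?f \<notin> inv_funs w"
  proof
    assume "?f \<in> inv_funs w"
    then have "?f (w i) = ?f i" using i by (simp add: inv_funs_def)
    then show False using ne by (simp add: o split: if_splits)
  qed
  ultimately have "inv_funs w \<subset> inv_funs (w \<circ> ?t)" using sub by blast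
  then have "card (inv_funs w) < card (inv_funs (w \<circ> ?t))"
    using finite_inv_funs[OF v] by (rule psubset_card_mono[rotated])
  then have "(3::nat) ^ npos w < 3 ^ npos (w \<circ> ?t)" using card_inv_funs w v by simp
  then have "npos w < npos (w \<circ> ?t)" by (rule power_less_imp_less_exp[rotated]) simp
  then show ?thesis using npos_comp_reflection(3)[OF w t] by simp
qed

text \<open>Each factor lowers the dimension of the fixed space, initially \<open>n\<close>, by at
  most one.\<close>

lemma reflection_product:
  "set ts \<subseteq> reflections n \<Longrightarrow>
    foldr (\<circ>) ts id \<in> hyperoctahedral n \<and> n \<le> npos (foldr (\<circ>) ts id) + length ts"
proof (induction ts)
  case Nil
  have "foldr (\<circ>) [] id = (id :: int \<Rightarrow> int)" by (simp only: foldr.simps id_apply)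
  then show ?case using npos_id id_in_H by presburger
next
  case (Cons t ts)
  then have t: "t \<in> reflections n" and ts: "set ts \<subseteq> reflections n" by auto
  have IH: "foldr (\<circ>) ts id \<in> hyperoctahedral n" "n \<le> npos (foldr (\<circ>) ts id) + length ts"
    using Cons.IH[OF ts] by blast+
  have "foldr (\<circ>) (t # ts) id = t \<circ> foldr (\<circ>) ts id" by (simp only: foldr.simps comp_apply)
  moreover have "n \<le> npos (t \<circ> foldr (\<circ>) ts id) + length (t # ts)"
    using npos_comp_reflection(2)[OF IH(1) t] IH(2) unfolding list.size by linarith
  ultimately show ?case
    using comp_in_H[OF reflection_in_H[OF t] IH(1)] by presburger
qed

lemma foldr_comp_append: "foldr (\<circ>) (ts @ [t]) id = foldr (\<circ>) ts id \<circ> t"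
  by (induction ts) (auto simp: comp_assoc)

text \<open>Splitting off \<open>srefl i (w i)\<close> at a moved point gains one dimension each
  time. Once the dimension is \<open>n\<close>, no point can be moved, since it would gain a
  dimension beyond \<open>n\<close>.\<close>

lemma ex_reflection_product:
  "w \<in> hyperoctahedral n \<Longrightarrow>
    \<exists>ts. length ts = n - npos w \<and> set ts \<subseteq> reflections n \<and> foldr (\<circ>) ts id = w"
proof (induction "n - npos w" arbitrary: w)
  case 0
  have "w = id"
  proof (rule ccontr)
    assume "w \<noteq> id"
    then obtain i where "w i \<noteq> i" by (auto simp: fun_eq_iff)
    moreover then have i: "i \<in> pm n" using H_permutes[OF 0(2)] by (auto simp: permutes_def)
    ultimately have "npos (w \<circ> srefl i (w i)) = npos w + 1" using npos_step[OF 0(2)] by blast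
    moreover have "npos (w \<circ> srefl i (w i)) \<le> n"
      using npos_le comp_in_H[OF 0(2)] srefl_in_H[OF i] 0(2) i by simp
    ultimately show False using 0(1) by simp
  qed
  moreover have "foldr (\<circ>) [] id = (id :: int \<Rightarrow> int)" by (simp only: foldr.simps id_apply)
  ultimately show ?case using 0(1) by (intro exI[of _ "[]"]) auto
next
  case (Suc m)
  have "w \<noteq> id" using Suc(2) npos_id by auto
  then obtain i where ne: "w i \<noteq> i" by (auto simp: fun_eq_iff)
  then have i: "i \<in> pm n" using H_permutes[OF Suc(3)] by (auto simp: permutes_def)
  let ?t = "srefl i (w i)"
  have t: "?t \<in> reflections n" using i ne Suc(3) unfolding reflections_eq by (intro CollectI exI) auto
  have "npos (w \<circ> ?t) = npos w + 1" using npos_step[OF Suc(3) i ne] .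
  then have "m = n - npos (w \<circ> ?t)" using Suc(2) by simp
  then obtain ts where ts: "length ts = n - npos (w \<circ> ?t)" "set ts \<subseteq> reflections n"
      "foldr (\<circ>) ts id = w \<circ> ?t"
    using Suc(1)[OF _ comp_in_H[OF Suc(3) reflection_in_H[OF t]]] by blast
  have "foldr (\<circ>) (ts @ [?t]) id = w"
    unfolding foldr_comp_append ts(3) by (simp add: comp_assoc reflection_comp_self[OF t])
  moreover have "length (ts @ [?t]) = n - npos w"
    using ts(1) Suc(2) \<open>npos (w \<circ> ?t) = npos w + 1\<close> by simp
  ultimately show ?case using ts(2) t by (intro exI[of _ "ts @ [?t]"]) auto
qed

text \<open>Carter's description of the reflection length as the codimension of the fixed
  space.\<close>

lemma reflection_length_eq:
  assumes w: "w \<in> hyperoctahedral n"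
  shows "reflection_length n w = n - npos w"
  unfolding reflection_length_def
proof (rule Least_equality)
  show "\<exists>ts. length ts = n - npos w \<and> set ts \<subseteq> reflections n \<and> foldr (\<circ>) ts id = w"
    by (rule ex_reflection_product[OF w])
  fix y assume "\<exists>ts. length ts = y \<and> set ts \<subseteq> reflections n \<and> foldr (\<circ>) ts id = w"
  then show "n - npos w \<le> y" using reflection_product by fastforce
qed

text \<open>The bridge from lengths to cycle counts on \<open>pm n\<close>, with the correction by
  balanced orbits.\<close>

lemma two_reflection_length:
  assumes w: "w \<in> hyperoctahedral n"
  shows "2 * reflection_length n w + ncyc w = 2 * n + card (bal_orbits w)"
  using ncyc_eq[OF w] reflection_length_eq[OF w] npos_le[OF w] by simp

lemma reflection_length_0:
  assumes w: "w \<in> hyperoctahedral n" and "reflection_length n w = 0"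
  shows "w = id"
  using ex_reflection_product[OF w] assms(2) reflection_length_eq[OF w] by auto

lemma absolute_le_antisym:
  assumes v: "v \<in> hyperoctahedral n" and w: "w \<in> hyperoctahedral n"
    and le: "absolute_le n v w" "absolute_le n w v"
  shows "v = w"
proof -
  have "reflection_length n (w \<circ> inv v) = 0" using le by (simp add: absolute_le_def)
  then have "w \<circ> inv v = id" using reflection_length_0 comp_in_H[OF w inv_in_H[OF v]] by blast
  then have "w (inv v (v i)) = v i" for i by (metis comp_apply id_apply)
  then show ?thesis using permutes_inverses(2)[OF H_permutes[OF v]] by (simp add: fun_eq_iff)
qed

lemma absolute_le_id: "absolute_le n id w"
  using reflection_length_eq[OF id_in_H] npos_id by (simp add: absolute_le_def)

lemma absolute_le_reflection_iff:
  assumes w: "w \<in> hyperoctahedral n" and t: "t \<in> reflections n"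
  shows "absolute_le n t w \<longleftrightarrow> npos (w \<circ> t) = npos w + 1"
proof -
  note tH = reflection_in_H[OF t]
  obtain a b where "t = srefl a b" "a \<in> pm n" "b \<in> pm n" "a \<noteq> b" using t by (rule reflectionE)
  then have a: "a \<in> pm n" "t a \<noteq> a" by (auto simp: srefl_def)
  have "npos t + 1 \<le> n"
    using npos_step[OF tH a] npos_le[OF comp_in_H[OF tH srefl_in_H[of a "t a"]]] tH a by simp
  moreover have "n \<le> npos t + 1" using reflection_product[of "[t]"] t by simp
  ultimately have t1: "reflection_length n t = 1" using reflection_length_eq[OF tH] by simp
  show ?thesis
    using reflection_length_eq[OF w] reflection_length_eq[OF comp_in_H[OF w tH]] t1
      npos_le[OF w] npos_le[OF comp_in_H[OF w tH]] npos_comp_reflection[OF w t]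
    by (auto simp: absolute_le_def reflection_inv[OF t])
qed

lemma srefl_step_le:
  assumes w: "w \<in> hyperoctahedral n" and i: "i \<in> pm n" and ne: "w i \<noteq> i"
  shows "srefl i (w i) \<in> reflections n" "absolute_le n (srefl i (w i)) w"
proof -
  show t: "srefl i (w i) \<in> reflections n" using i ne w unfolding reflections_eq by (intro CollectI exI) auto
  show "absolute_le n (srefl i (w i)) w"
    using npos_step[OF w i ne] absolute_le_reflection_iff[OF w t] by simp
qed

text \<open>If the reflection lies below \<open>w\<close>, the fixed space of \<open>w\<close> has a
  third of the elements of that of \<open>w \<circ> ?t\<close>, so it is the whole section of the
  latter by the hyperplane of the reflection. Thus all functions invariant under \<open>w\<close>
  agree at \<open>a\<close> and \<open>b\<close>, and the indicators of unbalanced orbits decide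
  which orbits these are. Balanced orbits carry only zero values and remain as the second
  alternative.\<close>

lemma srefl_le_imp:
  assumes w: "w \<in> hyperoctahedral n" and ab: "a \<in> pm n" "b \<in> pm n" "a \<noteq> b"
    and le: "absolute_le n (srefl a b) w"
  shows "b \<in> orbit w a \<or> - a \<in> orbit w a \<and> - b \<in> orbit w b"
proof -
  note p = H_permutes[OF w]
  let ?t = "srefl a b"
  have t: "?t \<in> reflections n" using ab unfolding reflections_eq by blast
  note tH = reflection_in_H[OF t]
  note v = comp_in_H[OF w tH]
  have wtt: "w \<circ> ?t \<circ> ?t = w" using reflection_comp_self[OF t] by (simp add: comp_assoc)
  have sub: "inv_funs (w \<circ> ?t) \<inter> inv_funs ?t \<subseteq> inv_funs w"
    using inv_funs_comp[OF v tH] wtt by simp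
  have "npos (w \<circ> ?t) = npos w + 1" using le absolute_le_reflection_iff[OF w t] by simp
  then have "card (inv_funs (w \<circ> ?t)) = 3 * card (inv_funs w)"
    using card_inv_funs[OF w] card_inv_funs[OF v] by simp
  then have "card (inv_funs w) \<le> card (inv_funs (w \<circ> ?t) \<inter> inv_funs ?t)"
    using card_inv_funs_le[OF v t] by simp
  then have "inv_funs (w \<circ> ?t) \<inter> inv_funs ?t = inv_funs w"
    using card_seteq[OF finite_inv_funs[OF w] sub] by simp
  then have *: "f a = f b" if "f \<in> inv_funs w" for f
    using that inv_funs_refl[OF ab(1,2)] inv_funs_subset_id by blast
  have "b \<in> orbit w a" if "- a \<notin> orbit w a"
    using *[OF orbit_indicator[OF w ab(1) that]] self_in_orbit[OF p]
    by (simp split: if_splits)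
  moreover have "a \<in> orbit w b" if "- b \<notin> orbit w b"
    using *[OF orbit_indicator[OF w ab(2) that]] self_in_orbit[OF p]
    by (simp split: if_splits)
  ultimately show ?thesis using orbit_swap[OF self_in_orbit[OF p]] by blast
qed

subsection \<open>The Coxeter element\<close>

abbreviation cox :: "int \<Rightarrow> int" where
  "cox \<equiv> coxeter_element n"

lemma key_range: "i \<in> pm n \<Longrightarrow> 1 \<le> key n i \<and> key n i \<le> 2 * n"
  by (auto simp: key_def pm_def)

lemma cox_permutes: "cox permutes pm n"
proof -
  have "set (map uminus [1..int n] @ [1..int n]) = pm n"
    by (auto simp: pm_def image_iff intro!: bexI[of _ "- _"])
  then show ?thesis using cycle_permutes unfolding coxeter_element_def by metis
qed

lemma key_cox:
  assumes i: "i \<in> pm n"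
  shows "key n (cox i) = (if key n i = 2 * n then 1 else key n i + 1)"
proof -
  let ?cs = "map uminus [1..int n] @ [1..int n]"
  have len: "length ?cs = 2 * n" by simp
  \<comment> \<open>Ranks start at 1, positions in the list at 0.\<close>
  have nth: "key n (?cs ! m) = m + 1" if "m < 2 * n" for m
    using that by (auto simp: nth_append nth_upto key_def)
  have in_pm: "?cs ! m \<in> pm n" if "m < 2 * n" for m
    using that by (auto simp: nth_append nth_upto pm_def)
  have "distinct ?cs" by (auto simp: distinct_map inj_on_def)
  then have "map (cox ^^ 1) ?cs = rotate 1 ?cs"
    unfolding coxeter_element_def by (rule cyclic_rotation)
  then have step: "cox (?cs ! m) = ?cs ! (Suc m mod (2 * n))" if "m < 2 * n" for m
    using that len nth_map[of m ?cs "cox ^^ 1"] nth_rotate[of m ?cs 1] by (simp add: mult_2)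
  define m where "m = key n i - 1"
  have m: "m < 2 * n" "key n i = m + 1" using key_range[OF i] by (auto simp: m_def)
  have "?cs ! m = i" using nth[OF m(1)] m(2) in_pm[OF m(1)] i k_eqD by simp
  then have c: "cox i = ?cs ! (Suc m mod (2 * n))" using step[OF m(1)] by simp
  show ?thesis
  proof (cases "Suc m = 2 * n")
    case True
    then show ?thesis using c nth[of 0] m by simp
  next
    case False
    then have "Suc m < 2 * n" using m by simp
    then show ?thesis using c nth[of "Suc m"] m by simp
  qed
qed

text \<open>On ranks, the unit step commutes with the half turn.\<close>

lemma cox_in_H: "cox \<in> hyperoctahedral n"
proof -
  have "cox (- i) = - cox i" if i: "i \<in> pm n" for i
  proof (rule k_eqD)
    have c: "cox i \<in> pm n" "cox (- i) \<in> pm n" using cox_permutes i by (simp_all add: permutes_in_image)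
    then show "cox (- i) \<in> pm n" "- cox i \<in> pm n" by simp_all
    show "key n (cox (- i)) = key n (- cox i)"
      using key_cox[OF i] key_cox[of "- i"] i key_neg[OF i] key_neg[OF c(1)] key_range[OF i]
        key_range[OF c(1)] key_range[of "- i"] key_range[of "- cox i"] c
      by (auto split: if_splits)
  qed
  then show ?thesis using cox_permutes by (simp add: hyperoctahedral_def)
qed

text \<open>The only weak drop has rank \<open>2 n\<close>. Every cycle contains a weak drop, so all
  cycles share this point.\<close>

lemma full_rotation_cox: "full_rotation cox"
proof -
  have w: "key n i = 2 * n" if "i \<in> wdrop cox" for i
    using that key_cox[of i] key_range[of i] by (auto simp: wdrop_def split: if_splits)
  have rot: "rotational cox"
    unfolding rotational_def
  proof (intro conjI ballI cox_permutes)
    fix i y assume "i \<in> wdrop cox" "y \<in> orbit cox i"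
    then show "key n y \<le> key n i"
      using w[of i] key_range[of y] orbit_in_X[OF cox_permutes] by (auto simp: wdrop_def)
  qed
  have "orbit cox i = pm n" if i: "i \<in> pm n" for i
  proof
    show "orbit cox i \<subseteq> pm n" using orbit_in_X[OF cox_permutes i] by blast
    show "pm n \<subseteq> orbit cox i"
    proof
      fix j assume j: "j \<in> pm n"
      obtain m where m: "m \<in> orbit cox i" "m \<in> wdrop cox" using ex_orbit_max[OF cox_permutes i] by metis
      obtain p where p: "p \<in> orbit cox j" "p \<in> wdrop cox" using ex_orbit_max[OF cox_permutes j] by metis
      have "m = p" using w[OF m(2)] w[OF p(2)] m p k_eqD by (simp add: wdrop_def)
      then have "orbit cox i = orbit cox j" using m p orbit_eq[OF cox_permutes] by metis
      then show "j \<in> orbit cox i" using self_in_orbit[OF cox_permutes] by simp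
    qed
  qed
  then show ?thesis using rot by (simp add: full_rotation_def)
qed

text \<open>An even function is multiplied over a transversal of \<open>i \<mapsto> -i\<close>, so the product does not depend
  on the transversal. This makes \<open>eps\<close> a linear character.\<close>

definition eps :: "(int \<Rightarrow> int) \<Rightarrow> int" where
  "eps w = (\<Prod>i\<in>{1..int n}. sgn i * sgn (w i))"

lemma prod_transversal:
  fixes g :: "int \<Rightarrow> int"
  assumes J: "J \<subseteq> pm n" "\<And>i. i \<in> pm n \<Longrightarrow> i \<in> J \<longleftrightarrow> - i \<notin> J"
    and g: "\<And>i. g (- i) = g i"
  shows "prod g J = prod g {1..int n}"
proof -
  have "bij_betw abs J {1..int n}"
    unfolding bij_betw_def
  proof (intro conjI equalityI subsetI)
    show "inj_on abs J"
    proof (rule inj_onI)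
      fix x y assume xy: "x \<in> J" "y \<in> J" "\<bar>x\<bar> = \<bar>y\<bar>"
      then have "x = y \<or> x = - y" by linarith
      then show "x = y" using xy J by auto
    qed
    show "x \<in> {1..int n}" if "x \<in> abs ` J" for x using that J(1) by (fastforce simp: pm_def)
    show "x \<in> abs ` J" if "x \<in> {1..int n}" for x
    proof -
      have "x \<in> pm n" using that by (auto simp: pm_def)
      then have "x \<in> J \<or> - x \<in> J" using J by blast
      moreover have "x = \<bar>x\<bar>" "x = \<bar>- x\<bar>" using that by auto
      ultimately show ?thesis by (metis image_eqI)
    qed
  qed
  then have "prod (\<lambda>i. g \<bar>i\<bar>) J = prod g {1..int n}" by (rule prod.reindex_bij_betw)
  moreover have "g \<bar>i\<bar> = g i" for i using g by (simp add: abs_if)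
  ultimately show ?thesis by simp
qed

lemma eps_transversal:
  assumes w: "w \<in> hyperoctahedral n"
    and J: "J \<subseteq> pm n" "\<And>i. i \<in> pm n \<Longrightarrow> i \<in> J \<longleftrightarrow> - i \<notin> J"
  shows "eps w = (\<Prod>i\<in>J. sgn i * sgn (w i))"
  unfolding eps_def
  by (rule prod_transversal[symmetric, OF J]) (auto simp: H_neg[OF w] sgn_minus)

lemma eps_comp:
  assumes u: "u \<in> hyperoctahedral n" and v: "v \<in> hyperoctahedral n"
  shows "eps (u \<circ> v) = eps u * eps v"
proof -
  let ?I = "{1..int n}"
  note pv = H_permutes[OF v]
  have "eps u = (\<Prod>i\<in>v ` ?I. sgn i * sgn (u i))"
  proof (rule eps_transversal[OF u])
    show "v ` ?I \<subseteq> pm n" using v by (auto simp: pm_def[of n, symmetric]) (auto simp: pm_def)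
    fix i assume i: "i \<in> pm n"
    define j where "j = inv v i"
    have ij: "i = v j" using permutes_inverses[OF pv] by (simp add: j_def)
    have jpm: "j \<in> pm n" using i v ij by simp
    have "v j \<in> v ` ?I \<longleftrightarrow> j \<in> ?I" "v (- j) \<in> v ` ?I \<longleftrightarrow> - j \<in> ?I"
      by (simp_all only: inj_image_mem_iff[OF permutes_inj[OF pv]])
    moreover have "j \<in> ?I \<longleftrightarrow> - j \<notin> ?I" using jpm by (auto simp: pm_def)
    ultimately show "i \<in> v ` ?I \<longleftrightarrow> - i \<notin> v ` ?I" using ij H_neg[OF v] by simp
  qed
  also have "\<dots> = (\<Prod>i\<in>?I. sgn (v i) * sgn (u (v i)))"
    by (subst prod.reindex) (auto intro: permutes_inj_on[OF pv])
  finally have "eps u * eps v = (\<Prod>i\<in>?I. (sgn (v i) * sgn (u (v i))) * (sgn i * sgn (v i)))"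
    by (simp add: eps_def prod.distrib)
  also have "\<dots> = eps (u \<circ> v)"
    unfolding eps_def
  proof (rule prod.cong)
    fix i assume i: "i \<in> ?I"
    then have "i \<in> pm n" by (auto simp: pm_def)
    then have "v i \<in> pm n" using v by simp
    then have "sgn (v i) * sgn (v i) = 1" by (auto simp: pm_def sgn_if)
    moreover have "(sgn (v i) * sgn (u (v i))) * (sgn i * sgn (v i)) =
        (sgn (v i) * sgn (v i)) * (sgn i * sgn (u (v i)))" by (simp only: ac_simps)
    ultimately show "(sgn (v i) * sgn (u (v i))) * (sgn i * sgn (v i)) = sgn i * sgn ((u \<circ> v) i)"
      by simp
  qed simp
  finally show ?thesis by simp
qed

text \<open>Without balanced orbits, the union of the selected orbits is a transversal that
  \<open>w\<close> maps to itself, and the signs of the points and of their images have the same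
  product.\<close>

lemma eps_eq_1:
  assumes w: "w \<in> hyperoctahedral n" and b: "bal_orbits w = {}"
  shows "eps w = 1"
proof -
  note p = H_permutes[OF w]
  let ?J = "{i \<in> pm n. orbit w i \<in> pos_orbits w}"
  have nb: "- i \<notin> orbit w i" if "i \<in> pm n" for i
    using that b balanced_iff[OF w] by (auto simp: bal_orbits_def)
  have "eps w = (\<Prod>i\<in>?J. sgn i * sgn (w i))"
    by (rule eps_transversal[OF w]) (use orbit_trichotomy[OF w] nb in auto)
  also have "\<dots> = (\<Prod>i\<in>?J. sgn i) * (\<Prod>i\<in>?J. sgn (w i))" by (rule prod.distrib)
  also have "(\<Prod>i\<in>?J. sgn (w i)) = (\<Prod>i\<in>?J. sgn i)"
  proof (rule prod.reindex_bij_betw)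
    have o: "orbit w (w i) = orbit w i" for i using orbit_eq[OF p orbit.base] .
    have "w ` ?J \<subseteq> ?J" using w o by auto
    then show "bij_betw w ?J ?J"
      using endo_inj_surj[of ?J w] permutes_inj_on[OF p] finite_pm by (auto simp: bij_betw_def)
  qed
  also have "(\<Prod>i\<in>?J. sgn i) * (\<Prod>i\<in>?J. sgn i) = (\<Prod>i\<in>?J. sgn i * sgn i)"
    by (rule prod.distrib[symmetric])
  also have "\<dots> = 1" by (rule prod.neutral) (auto simp: pm_def sgn_if)
  finally show ?thesis .
qed

text \<open>Among the positive letters only \<open>n\<close> changes sign, being sent to
  \<open>-1\<close>.\<close>

lemma eps_cox:
  assumes "n \<ge> 1"
  shows "eps cox = -1"
proof -
  have "eps cox = (\<Prod>i\<in>{1..int n}. if i = int n then -1 else 1)"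
    unfolding eps_def
  proof (rule prod.cong)
    fix i assume i: "i \<in> {1..int n}"
    then have ipm: "i \<in> pm n" by (auto simp: pm_def)
    then have cpm: "cox i \<in> pm n" using cox_in_H by simp
    have ki: "key n i = n + nat i" using i by (auto simp: key_def nat_add_distrib)
    show "sgn i * sgn (cox i) = (if i = int n then -1 else 1)"
    proof (cases "i = int n")
      case True
      then have "key n (cox i) = 1" using key_cox[OF ipm] ki by simp
      then have "cox i < 0" using key_neg[OF cpm] assms by auto
      then show ?thesis using True assms by simp
    next
      case False
      then have "key n (cox i) = n + nat i + 1" using key_cox[OF ipm] ki i by auto
      then have "cox i > 0" using key_neg[OF cpm] by auto
      then show ?thesis using False i by simp
    qed
  qed simp
  also have "\<dots> = -1" using assms by (simp add: prod.delta)
  finally show ?thesis .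
qed

subsection \<open>Noncrossing partitions and the absolute order\<close>

lemma finite_bal_orbits: "finite (bal_orbits w)"
  by (simp add: bal_orbits_def finite_pm)

text \<open>The lengths of \<open>u\<close> and \<open>?x\<close> add up to \<open>n\<close>, so
  their cycles number \<open>2 n\<close> plus their balanced orbits. The latter cannot be absent
  because \<open>eps cox = -1\<close>, and \<open>ncyc_quotient_le\<close> leaves room for only one;
  hence equality holds there.\<close>

lemma below_cox:
  assumes n: "n \<ge> 1" and u: "u \<in> hyperoctahedral n" and le: "absolute_le n u cox"
  shows "rotational u" "noncrossing u"
proof -
  let ?x = "cox \<circ> inv u"
  note c = cox_in_H and pu = H_permutes[OF u]
  have x: "?x \<in> hyperoctahedral n" using comp_in_H[OF c inv_in_H[OF u]] .
  have ne: "pm n \<noteq> {}" using n card_pm by auto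
  note full = full_rotation_cox
  have c1: "ncyc cox = 1" using ncyc_full_rotation[OF full ne] .
  \<comment> \<open>By parity: the single cycle cannot belong to a pair of opposite orbits.\<close>
  have "card (bal_orbits cox) = 1" using ncyc_eq[OF c] c1 by presburger
  then have lc: "reflection_length n cox = n" using two_reflection_length[OF c] c1 by simp
  have "int (reflection_length n ?x) = int n - int (reflection_length n u)"
    using le lc by (simp add: absolute_le_def)
  then have s: "ncyc u + ncyc ?x = 2 * n + (card (bal_orbits u) + card (bal_orbits ?x))"
    using two_reflection_length[OF u] two_reflection_length[OF x] by linarith
  have "card (bal_orbits u) + card (bal_orbits ?x) \<noteq> 0"
  proof
    assume "card (bal_orbits u) + card (bal_orbits ?x) = 0"
    then have "bal_orbits u = {}" "bal_orbits ?x = {}" using finite_bal_orbits by auto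
    then have "eps (?x \<circ> u) = 1" using eps_eq_1 u x eps_comp[OF x u] by simp
    moreover have "?x \<circ> u = cox" using permutes_inv_o(2)[OF pu] by (simp add: comp_assoc)
    ultimately show False using eps_cox[OF n] by simp
  qed
  then have e: "ncyc u + ncyc ?x = card (pm n) + 1"
    using s ncyc_quotient_le[OF full ne pu] card_pm by linarith
  show "rotational u" using geodesic_imp_rotational[OF full ne pu e] .
  show "noncrossing u" using geodesic_imp_noncrossing[OF full ne pu e] .
qed

text \<open>The chords from \<open>i\<close> to \<open>- i\<close> and from \<open>j\<close> to
  \<open>- j\<close> are diameters of the circle of ranks, and two distinct diameters cross.\<close>

lemma antipodal_crossing:
  assumes R: "equiv (pm n) R" "noncrossing_rel R" and ij: "(i, - i) \<in> R" "(j, - j) \<in> R"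
  shows "(i, j) \<in> R"
proof -
  have sw: "(b, a) \<in> R" if "(a, b) \<in> R" for a b using R that by (auto simp: equiv_def dest: symD)
  have tr: "(a, c) \<in> R" if "(a, b) \<in> R" "(b, c) \<in> R" for a b c
    using R that by (auto simp: equiv_def dest: transD)
  have pmR: "a \<in> pm n" if "(a, b) \<in> R" for a b using equiv_type[OF R(1)] that by auto
  have nc: "(a, b) \<in> R" if "(a, c) \<in> R" "(b, d) \<in> R" "key n a < key n b" "key n b < key n c"
    "key n c < key n d" for a b c d
    using R(2) that unfolding noncrossing_rel_def by blast
  have neg: "(a, b) \<in> R" if ab: "(a, - a) \<in> R" "(b, - b) \<in> R" "a < 0" "b < 0" for a b
  proof -
    have k: "key n (- a) = key n a + n" "key n (- b) = key n b + n" "key n a \<le> n" "key n b \<le> n"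
      using key_neg[OF pmR[OF ab(1)]] key_neg[OF pmR[OF ab(2)]] ab(3,4) by auto
    have pos: "0 < key n a" "0 < key n b" using key_range[OF pmR[OF ab(1)]] key_range[OF pmR[OF ab(2)]] by auto
    consider "key n a < key n b" | "key n b < key n a" | "a = b"
      using k_eqD[of a b] pmR ab by fastforce
    then show ?thesis
    proof cases
      case 1
      show ?thesis by (rule nc[OF ab(1,2)]) (use 1 k pos in linarith)+
    next
      case 2
      have "(b, a) \<in> R" by (rule nc[OF ab(2,1)]) (use 2 k pos in linarith)+
      then show ?thesis by (rule sw)
    next
      case 3
      then show ?thesis using ab sw tr by blast
    qed
  qed
  \<comment> \<open>Each diameter is represented by its negative end, whose rank lies in the first
    half.\<close>
  define i' where "i' = (if i < 0 then i else - i)"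
  define j' where "j' = (if j < 0 then j else - j)"
  have "i \<noteq> 0" "j \<noteq> 0" using pmR ij by (auto simp: pm_def)
  then have "(i', - i') \<in> R" "(j', - j') \<in> R" "i' < 0" "j' < 0" "(i, i') \<in> R" "(j, j') \<in> R"
    using ij ij[THEN sw] tr[OF ij(1) sw[OF ij(1)]] tr[OF ij(2) sw[OF ij(2)]]
    by (simp_all add: i'_def j'_def)
  then show ?thesis using neg[of i' j'] sw tr by blast
qed

lemma card_bal_orbits_le_1:
  assumes u: "u \<in> hyperoctahedral n" and nc: "noncrossing u"
  shows "card (bal_orbits u) \<le> 1"
proof -
  note p = H_permutes[OF u]
  let ?R = "{(a, b). a \<in> pm n \<and> b \<in> orbit u a}"
  note R = noncrossing_rel_of_orbits(1)[OF p] noncrossing_rel_of_orbits(2)[OF p nc]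
  have "P = Q" if PQ: "P \<in> bal_orbits u" "Q \<in> bal_orbits u" for P Q
  proof -
    obtain i j where ij: "i \<in> pm n" "P = orbit u i" "j \<in> pm n" "Q = orbit u j"
      using PQ by (auto simp: bal_orbits_def)
    then have "- i \<in> orbit u i" "- j \<in> orbit u j"
      using PQ balanced_iff[OF u] by (auto simp: bal_orbits_def)
    then have "j \<in> orbit u i" using antipodal_crossing[OF R, of i j] ij by auto
    then show ?thesis using orbit_eq[OF p] ij by simp
  qed
  then show ?thesis using card_le_Suc0_iff_eq[OF finite_bal_orbits] by simp
qed

text \<open>Cycle counts add up by \<open>ncyc_quotient\<close>, so additivity of lengths amounts to
  additivity of the numbers of balanced orbits. Each of these is at most 1, since balanced orbits
  contain diameters.\<close>

lemma absolute_le_if_refines: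
  assumes u: "u \<in> hyperoctahedral n" "rotational u" "noncrossing u"
    and v: "v \<in> hyperoctahedral n" "rotational v" "noncrossing v"
    and sub: "\<And>i. i \<in> pm n \<Longrightarrow> orbit u i \<subseteq> orbit v i"
  shows "absolute_le n u v"
proof -
  let ?x = "v \<circ> inv u"
  have x: "?x \<in> hyperoctahedral n" using comp_in_H[OF v(1) inv_in_H[OF u(1)]] .
  note q = u(2) v(2) u(3) sub
  have xsub: "orbit ?x i \<subseteq> orbit v i" if "i \<in> pm n" for i
    using orbit_quotient_subset[OF q that] .
  have b1: "card (bal_orbits u) \<le> 1" "card (bal_orbits v) \<le> 1" "card (bal_orbits ?x) \<le> 1"
    using card_bal_orbits_le_1[OF u(1,3)] card_bal_orbits_le_1[OF v(1,3)]
      card_bal_orbits_le_1[OF x noncrossing_quotient[OF q v(3)]] by auto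
  have bal: "bal_orbits y = {}" if "bal_orbits v = {}" "y \<in> hyperoctahedral n"
    "\<And>i. i \<in> pm n \<Longrightarrow> orbit y i \<subseteq> orbit v i" for y
  proof (rule ccontr)
    assume "bal_orbits y \<noteq> {}"
    then obtain i where i: "i \<in> pm n" "uminus ` orbit y i = orbit y i" by (auto simp: bal_orbits_def)
    then have "- i \<in> orbit v i" using balanced_iff[OF that(2)] that(3) by blast
    then have "orbit v i \<in> bal_orbits v" using balanced_iff[OF v(1)] i(1) by (simp add: bal_orbits_def)
    then show False using that(1) by simp
  qed
  have b0: "card (bal_orbits u) = 0 \<and> card (bal_orbits ?x) = 0" if "card (bal_orbits v) = 0"
    using that bal[OF _ u(1) sub] bal[OF _ x xsub] finite_bal_orbits by auto
  have "ncyc ?x + ncyc u = 2 * n + ncyc v" using ncyc_quotient[OF q] card_pm by simp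
  \<comment> \<open>Unbalanced orbits come in pairs, so the cycle identity gives the claim modulo 2.
    With the bounds by 1 this settles the case where \<open>v\<close> has a balanced orbit;
    otherwise \<open>b0\<close> applies, because a balanced orbit makes the \<open>v\<close>-orbit
    around it balanced.\<close>
  then have "card (bal_orbits ?x) + card (bal_orbits u) = card (bal_orbits v)"
    using ncyc_eq[OF x] ncyc_eq[OF u(1)] ncyc_eq[OF v(1)] b1 b0 by presburger
  then show ?thesis
    using two_reflection_length[OF x] two_reflection_length[OF u(1)] two_reflection_length[OF v(1)]
      \<open>ncyc ?x + ncyc u = 2 * n + ncyc v\<close> by (simp add: absolute_le_def)
qed

section \<open>Symmetry of the closure and of its rotation under negation\<close>

text \<open>The negated closure is again a noncrossing equivalence containing the steps of
  \<open>w\<close>, so minimality applies to it. The difficulty is that negation preserves the order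
  of the ranks only cyclically.\<close>

lemma noncrossing_closure_neg:
  assumes w: "w \<in> hyperoctahedral n" and ab: "(a, b) \<in> noncrossing_closure w"
  shows "(- a, - b) \<in> noncrossing_closure w"
proof -
  let ?R = "noncrossing_closure w"
  let ?E = "{(a, b). (- a, - b) \<in> ?R}"
  have R: "equiv (pm n) ?R" using equiv_noncrossing_closure[OF H_permutes[OF w]] .
  have sw: "(b, a) \<in> ?R" if "(a, b) \<in> ?R" for a b using R that by (auto simp: equiv_def dest: symD)
  have tr: "(a, c) \<in> ?R" if "(a, b) \<in> ?R" "(b, c) \<in> ?R" for a b c
    using R that by (auto simp: equiv_def dest: transD)
  have pmR: "a \<in> pm n" "b \<in> pm n" if "(a, b) \<in> ?R" for a b using equiv_type[OF R] that by auto
  have ncR: "(a, b) \<in> ?R" if "(a, c) \<in> ?R" "(b, d) \<in> ?R" "key n a < key n b"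
    "key n b < key n c" "key n c < key n d" for a b c d
    using noncrossing_rel_closure that unfolding noncrossing_rel_def by blast
  have "?E \<subseteq> pm n \<times> pm n" using pmR by fastforce
  moreover have "sym ?E" using sw by (auto intro!: symI)
  moreover have "trans ?E" using tr by (auto intro!: transI)
  moreover have "(i, i) \<in> ?E" if "i \<in> pm n" for i
    using R that by (auto simp: equiv_def refl_on_def)
  ultimately have "equiv (pm n) ?E" by (auto simp: equiv_def refl_on_def)
  moreover have "noncrossing_rel ?E"
    unfolding noncrossing_rel_def
  proof (intro allI impI)
    fix a b c d assume ac: "(a, c) \<in> ?E" and bd: "(b, d) \<in> ?E"
      and lt: "key n a < key n b" "key n b < key n c" "key n c < key n d"
    have AC: "(- a, - c) \<in> ?R" and BD: "(- b, - d) \<in> ?R" using ac bd by auto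
    have P: "a \<in> pm n" "b \<in> pm n" "c \<in> pm n" "d \<in> pm n" using pmR[OF AC] pmR[OF BD] by auto
    note K = key_neg[OF P(1)] key_neg[OF P(2)] key_neg[OF P(3)] key_neg[OF P(4)]
    have r: "key n i \<le> 2 * n" "0 < key n i" "0 < key n (- i)" if "i \<in> pm n" for i
      using key_range[OF that] key_range[of "- i"] that by auto
    note r = r[OF P(1)] r[OF P(2)] r[OF P(3)] r[OF P(4)]
    \<comment> \<open>A half turn leaves the four points in one of the cyclic shifts of their order.
      Noncrossing of the closure applies to each shift, and symmetry and transitivity then link
      \<open>- a\<close> to \<open>- b\<close>.\<close>
    have "(key n (- a) < key n (- b) \<and> key n (- b) < key n (- c) \<and> key n (- c) < key n (- d)) \<or>
      (key n (- b) < key n (- c) \<and> key n (- c) < key n (- d) \<and> key n (- d) < key n (- a)) \<or>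
      (key n (- c) < key n (- d) \<and> key n (- d) < key n (- a) \<and> key n (- a) < key n (- b)) \<or>
      (key n (- d) < key n (- a) \<and> key n (- a) < key n (- b) \<and> key n (- b) < key n (- c))"
      using K r lt by linarith
    then have "(- a, - b) \<in> ?R"
    proof (elim disjE conjE)
      assume "key n (- a) < key n (- b)" "key n (- b) < key n (- c)" "key n (- c) < key n (- d)"
      then show ?thesis using ncR[OF AC BD] by simp
    next
      assume "key n (- b) < key n (- c)" "key n (- c) < key n (- d)" "key n (- d) < key n (- a)"
      then have "(- b, - c) \<in> ?R" using ncR[OF BD sw[OF AC]] by simp
      then show ?thesis using AC sw tr by blast
    next
      assume "key n (- c) < key n (- d)" "key n (- d) < key n (- a)" "key n (- a) < key n (- b)"
      then have "(- c, - d) \<in> ?R" using ncR[OF sw[OF AC] sw[OF BD]] by simp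
      then show ?thesis using AC BD sw tr by blast
    next
      assume "key n (- d) < key n (- a)" "key n (- a) < key n (- b)" "key n (- b) < key n (- c)"
      then have "(- d, - a) \<in> ?R" using ncR[OF sw[OF BD] AC] by simp
      then show ?thesis using BD sw tr by blast
    qed
    then show "(a, b) \<in> ?E" by simp
  qed
  moreover have "(i, w i) \<in> ?E" if "i \<in> pm n" for i
    using step_in_noncrossing_closure[of "- i" w] that H_neg[OF w] by simp
  ultimately have "?R \<subseteq> ?E" by (rule noncrossing_closure_least)
  then show ?thesis using ab by blast
qed

text \<open>The half turn preserves the classes and the cyclic order, hence also the cyclic
  successor within a class. Concretely, \<open>- u (- i)\<close> competes with \<open>u i\<close> as
  successor of \<open>i\<close>, and \<open>- u i\<close> with \<open>u (- i)\<close> as successor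
  of \<open>- i\<close>.\<close>

lemma rotation_in_H:
  assumes r: "rotational u" and o: "\<And>i. i \<in> pm n \<Longrightarrow> orbit u i = R `` {i}"
    and neg: "\<And>a b. (a, b) \<in> R \<Longrightarrow> (- a, - b) \<in> R"
  shows "u \<in> hyperoctahedral n"
proof -
  note p = rotational_permutes[OF r]
  have "u (- i) = - u i" if i: "i \<in> pm n" for i
  proof (rule k_eqD)
    have ni: "- i \<in> pm n" using i by simp
    let ?a = "u i" and ?b = "u (- i)"
    have P: "?a \<in> pm n" "?b \<in> pm n" using p i by (simp_all add: permutes_in_image)
    then show "?b \<in> pm n" "- ?a \<in> pm n" by simp_all
    have "(i, ?a) \<in> R" using o[OF i] orbit.base[of u i] by auto
    then have na: "- ?a \<in> orbit u (- i)" using neg o[OF ni] by auto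
    have "(- i, ?b) \<in> R" using o[OF ni] orbit.base[of u "- i"] by auto
    then have nb: "- ?b \<in> orbit u i" using neg o[OF i] by force
    note f = rotational_max[OF r i _ nb] rotational_min[OF r i _ nb] rotational_no_between[OF r i nb]
      rotational_max[OF r ni _ na] rotational_min[OF r ni _ na] rotational_no_between[OF r ni na]
    note K = key_neg[OF i] key_neg[OF P(1)] key_neg[OF P(2)]
    have rg: "key n i \<le> 2 * n" "0 < key n i" "0 < key n (- i)" if "i \<in> pm n" for i
      using key_range[OF that] key_range[of "- i"] that by auto
    note rg = rg[OF i] rg[OF P(1)] rg[OF P(2)]
    show "key n ?b = key n (- ?a)"
      using f K rg by linarith
  qed
  then show ?thesis using p by (simp add: hyperoctahedral_def)
qed

section \<open>Reflections as noncrossing rotations, and the join\<close>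

lemma orbit_srefl:
  assumes "a \<in> pm n" "b \<in> pm n"
  shows "orbit (srefl a b) y = {y, srefl a b y}"
proof
  show "orbit (srefl a b) y \<subseteq> {y, srefl a b y}"
  proof
    fix z assume "z \<in> orbit (srefl a b) y"
    then show "z \<in> {y, srefl a b y}"
      by induction (auto simp: srefl_srefl[OF assms])
  qed
  show "{y, srefl a b y} \<subseteq> orbit (srefl a b) y"
    using self_in_orbit[OF H_permutes[OF srefl_in_H[OF assms]]] orbit.base by fast
qed

text \<open>Orbits with at most two points are always rotated increasingly. The two chords of a
  reflection are exchanged by the half turn, so they coincide or do not cross.\<close>

lemma
  assumes ab: "a \<in> pm n" "b \<in> pm n"
  shows rotational_srefl: "rotational (srefl a b)"
    and noncrossing_srefl: "noncrossing (srefl a b)"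
proof -
  note o = orbit_srefl[OF ab]
  show "rotational (srefl a b)"
    using H_permutes[OF srefl_in_H[OF ab]] by (auto simp: rotational_def wdrop_def o)
  note K = key_neg[OF ab(1)] key_neg[OF ab(2)] key_range[OF ab(1)] key_range[OF ab(2)]
  show "noncrossing (srefl a b)"
    unfolding noncrossing_def
  proof (intro ballI impI)
    fix p q s t assume *: "s \<in> orbit (srefl a b) p" "t \<in> orbit (srefl a b) q"
      and lt: "key n p < key n q" "key n q < key n s" "key n s < key n t"
    have s: "s = srefl a b p" "p \<noteq> s" and t: "t = srefl a b q" "q \<noteq> t" using * lt by (auto simp: o)
    have ps: "{p, s} = {a, b} \<or> {p, s} = {- a, - b}" using s by (auto simp: srefl_def split: if_splits)
    have qt: "{q, t} = {a, b} \<or> {q, t} = {- a, - b}" using t by (auto simp: srefl_def split: if_splits)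
    have False
      using ps qt lt K by (auto simp: doubleton_eq_iff)
    then show "q \<in> orbit (srefl a b) p" ..
  qed
qed

lemma orbit_subset_closure:
  assumes w: "w \<in> hyperoctahedral n" and i: "i \<in> pm n" and y: "y \<in> orbit w i"
  shows "(i, y) \<in> noncrossing_closure w"
proof -
  note R = equiv_noncrossing_closure[OF H_permutes[OF w]]
  have tr: "trans (noncrossing_closure w)" using R by (simp add: equiv_def)
  show ?thesis using y
  proof induction
    case base
    then show ?case using step_in_noncrossing_closure[OF i] .
  next
    case (step y)
    have "y \<in> pm n" using equiv_type[OF R] step(2) by auto
    then show ?case using step_in_noncrossing_closure[of y w] step(2) tr by (auto dest: transD)
  qed
qed

text \<open>The rotation of the closure bounds every reflection below \<open>w\<close>, because the
  chords of such a reflection lie in the closure. Conversely, the reflections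
  \<open>srefl i (w i)\<close> force the orbits of any upper bound to contain the steps of
  \<open>w\<close>, hence the closure. In both directions \<open>antipodal_crossing\<close> deals
  with the balanced alternative of \<open>srefl_le_imp\<close>.\<close>

lemma pi_T_eq_rotation:
  assumes n: "n \<ge> 1" and w: "w \<in> hyperoctahedral n"
  shows "rotational (pi_T n w cox)"
    and "pi_T n w cox \<in> hyperoctahedral n"
    and "i \<in> pm n \<Longrightarrow> orbit (pi_T n w cox) i = noncrossing_closure w `` {i}"
proof -
  let ?R = "noncrossing_closure w" and ?A = "{t \<in> reflections n. absolute_le n t w}"
  note pw = H_permutes[OF w]
  note R = equiv_noncrossing_closure[OF pw]
  have sw: "(b, a) \<in> ?R" if "(a, b) \<in> ?R" for a b using R that by (auto simp: equiv_def dest: symD)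
  have self: "(a, a) \<in> ?R" if "a \<in> pm n" for a using R that by (auto simp: equiv_def refl_on_def)
  note negR = noncrossing_closure_neg[OF w]
  obtain u where ru: "rotational u" and ou: "\<And>i. i \<in> pm n \<Longrightarrow> orbit u i = ?R `` {i}"
    using ex_rotation_of_classes[OF R] by metis
  have nu: "noncrossing u" using noncrossing_of_rel[OF noncrossing_rel_closure ou] .
  have u: "u \<in> hyperoctahedral n" using rotation_in_H[OF ru ou negR] .
  have rc: "rotational cox" and oc: "\<And>i. i \<in> pm n \<Longrightarrow> orbit cox i = pm n"
    using full_rotation_cox by (auto simp: full_rotation_def)
  have nc: "noncrossing cox" unfolding noncrossing_def using oc by blast
  have le_cox: "absolute_le n v cox" if "v \<in> hyperoctahedral n" "rotational v" "noncrossing v" for v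
    using absolute_le_if_refines[OF that cox_in_H rc nc] orbit_in_X[OF H_permutes[OF that(1)]] oc by blast
  have carrier: "v \<in> carrier (NC n cox) \<longleftrightarrow> v \<in> hyperoctahedral n \<and> absolute_le n v cox" for v
    using absolute_le_id by (auto simp: NC_def)
  have le: "le (NC n cox) = absolute_le n" by (simp add: NC_def)
  \<comment> \<open>\<open>Upper\<close> tests only elements of the carrier. All reflections lie in
    it, whether or not \<open>w\<close> does.\<close>
  have Acar: "t \<in> carrier (NC n cox)" if "t \<in> reflections n" for t
    using that carrier le_cox srefl_in_H rotational_srefl noncrossing_srefl by (auto elim!: reflectionE)
  have upper: "absolute_le n t u" if t: "t \<in> ?A" for t
  proof -
    obtain a b where ab: "t = srefl a b" "a \<in> pm n" "b \<in> pm n" "a \<noteq> b"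
      using t by (auto elim!: reflectionE)
    have "(a, b) \<in> ?R"
    proof (cases "b \<in> orbit w a")
      case True
      then show ?thesis using orbit_subset_closure[OF w ab(2)] by simp
    next
      case False
      then have "- a \<in> orbit w a" "- b \<in> orbit w b" using srefl_le_imp[OF w ab(2-4)] t ab(1) by auto
      then have "(a, - a) \<in> ?R" "(b, - b) \<in> ?R"
        using orbit_subset_closure[OF w ab(2)] orbit_subset_closure[OF w ab(3)] by auto
      then show ?thesis using antipodal_crossing[OF R noncrossing_rel_closure] by simp
    qed
    then have "(y, t y) \<in> ?R" if "y \<in> pm n" for y
      using negR[of a b] sw self[OF that] by (auto simp: ab(1) srefl_def)
    then have "orbit t y \<subseteq> orbit u y" if "y \<in> pm n" for y
      using that ou[OF that] self[OF that] by (auto simp: ab(1) orbit_srefl[OF ab(2,3)])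
    then show ?thesis
      using absolute_le_if_refines[OF _ _ _ u ru nu] srefl_in_H[OF ab(2,3)] rotational_srefl[OF ab(2,3)]
        noncrossing_srefl[OF ab(2,3)] ab(1) by simp
  qed
  have lower: "absolute_le n u v"
    if v: "v \<in> hyperoctahedral n" "absolute_le n v cox" and ub: "\<And>t. t \<in> ?A \<Longrightarrow> absolute_le n t v" for v
  proof -
    note pv = H_permutes[OF v(1)]
    note rv = below_cox[OF n v]
    let ?E = "{(a, b). a \<in> pm n \<and> b \<in> orbit v a}"
    note E = noncrossing_rel_of_orbits(1)[OF pv] noncrossing_rel_of_orbits(2)[OF pv rv(2)]
    have "(i, w i) \<in> ?E" if i: "i \<in> pm n" for i
    proof (cases "w i = i")
      case True
      then show ?thesis using i self_in_orbit[OF pv] by simp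
    next
      case False
      have wi: "w i \<in> pm n" using w i by simp
      have "absolute_le n (srefl i (w i)) v" using ub srefl_step_le[OF w i False] by simp
      then have "w i \<in> orbit v i \<or> - i \<in> orbit v i \<and> - w i \<in> orbit v (w i)"
        using srefl_le_imp[OF v(1) i wi] False by auto
      then show ?thesis using antipodal_crossing[OF E, of i "w i"] i wi by auto
    qed
    then have "?R \<subseteq> ?E" using noncrossing_closure_least[OF E] by blast
    then have "orbit u i \<subseteq> orbit v i" if "i \<in> pm n" for i using ou[OF that] by auto
    then show ?thesis using absolute_le_if_refines[OF u ru nu v(1) rv] by blast
  qed
  have Up: "v \<in> Upper (NC n cox) ?A \<longleftrightarrow>
      v \<in> hyperoctahedral n \<and> absolute_le n v cox \<and> (\<forall>t\<in>?A. absolute_le n t v)" for v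
    unfolding Upper_def using Acar carrier le by auto
  have "least (NC n cox) u (Upper (NC n cox) ?A)"
    unfolding least_def using Up u le_cox[OF u ru nu] upper lower le by auto
  \<comment> \<open>The join is picked by a choice operator, so uniqueness of the least upper bound
    is required.\<close>
  moreover have "x = u" if "least (NC n cox) x (Upper (NC n cox) ?A)" for x
    using that \<open>least (NC n cox) u _\<close> absolute_le_antisym[of x u] Up le
    by (auto simp: least_def)
  ultimately have "pi_T n w cox = u"
    unfolding pi_T_def Lattice.sup_def by (rule some_equality)
  then show "rotational (pi_T n w cox)" "pi_T n w cox \<in> hyperoctahedral n"
    "i \<in> pm n \<Longrightarrow> orbit (pi_T n w cox) i = ?R `` {i}"
    using ru u ou by auto
qed

subsection \<open>Counting antiexceedances\<close>

lemma card_prec_eq: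
  assumes v: "v \<in> hyperoctahedral n" and w: "w \<in> hyperoctahedral n"
  shows "card {i \<in> pm n. prec i (v (inv w i))} = card {j \<in> pm n. key n (w j) < key n (v j)}"
proof -
  note p = H_permutes[OF w]
  have "{i \<in> pm n. prec i (v (inv w i))} = w ` {j \<in> pm n. key n (w j) < key n (v j)}"
  proof (intro equalityI subsetI)
    fix i assume i: "i \<in> {i \<in> pm n. prec i (v (inv w i))}"
    show "i \<in> w ` {j \<in> pm n. key n (w j) < key n (v j)}"
      by (rule image_eqI[of _ _ "inv w i"])
        (use i v inv_in_H[OF w] prec_iff_key permutes_inverses[OF p] in auto)
  next
    fix i assume "i \<in> w ` {j \<in> pm n. key n (w j) < key n (v j)}"
    then show "i \<in> {i \<in> pm n. prec i (v (inv w i))}"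
      using v w prec_iff_key permutes_inverses[OF p] by auto
  qed
  then show ?thesis by (simp add: card_image permutes_inj_on[OF p])
qed

text \<open>The unique weak drop of a rotated cycle is strict exactly when the cycle is not a fixed
  point.\<close>

lemma cyc_gt1_rotational:
  assumes r: "rotational u"
  shows "cyc_gt1 n u = card {j \<in> pm n. key n (u j) < key n j}"
proof -
  note p = rotational_permutes[OF r]
  let ?D = "{j \<in> pm n. key n (u j) < key n j}"
  have "{C \<in> orbit u ` pm n. card C > 1} = orbit u ` ?D"
  proof (intro equalityI subsetI)
    fix C assume "C \<in> {C \<in> orbit u ` pm n. card C > 1}"
    then obtain i where i: "i \<in> pm n" "C = orbit u i" "card C > 1" by auto
    obtain m where m: "m \<in> orbit u i" "m \<in> wdrop u" using ex_orbit_max[OF p i(1)] by metis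
    have C: "C = orbit u m" using orbit_eq[OF p m(1)] i by simp
    have "u m \<noteq> m"
    proof
      assume "u m = m"
      then have "C = {m}" using C orbit_eq_singleton_iff by metis
      then show False using i by simp
    qed
    moreover have "m \<in> pm n" "u m \<in> pm n" "key n (u m) \<le> key n m"
      using m(2) p by (auto simp: wdrop_def permutes_in_image)
    ultimately have "m \<in> ?D" using k_eqD[of "u m" m] by fastforce
    then show "C \<in> orbit u ` ?D" using C by blast
  next
    fix C assume "C \<in> orbit u ` ?D"
    then obtain j where j: "j \<in> pm n" "key n (u j) < key n j" "C = orbit u j" by auto
    have "{j, u j} \<subseteq> orbit u j" using self_in_orbit[OF p] orbit.base by fast
    then have "card {j, u j} \<le> card C" using card_mono finite_orbit_X[OF p j(1)] j(3) by blast
    moreover have "j \<noteq> u j" using j(2) by auto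
    ultimately show "C \<in> {C \<in> orbit u ` pm n. card C > 1}" using j by auto
  qed
  moreover have "inj_on (orbit u) ?D"
  proof (rule inj_onI)
    fix i j assume ij: "i \<in> ?D" "j \<in> ?D" "orbit u i = orbit u j"
    have "key n i \<le> key n j" "key n j \<le> key n i"
      using rotational_max[OF r, of j i] rotational_max[OF r, of i j] ij self_in_orbit[OF p] by auto
    then show "i = j" using k_eqD ij by simp
  qed
  ultimately show ?thesis by (simp add: cyc_gt1_def card_image)
qed

lemma aexc_Pop:
  assumes n: "n \<ge> 1" and w: "w \<in> hyperoctahedral n"
  shows "aexc n w = aexc n (Pop_T n w cox) + cyc_gt1 n (pi_T n w cox)"
proof -
  let ?p = "pi_T n w cox"
  note P = pi_T_eq_rotation[OF n w]
  note pw = H_permutes[OF w] and pp = H_permutes[OF P(2)]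
  have "inv (Pop_T n w cox) = ?p \<circ> inv w"
    unfolding Pop_T_def
    using o_inv_distrib[OF permutes_bij[OF pw] permutes_bij[OF permutes_inv[OF pp]]]
      permutes_inv_inv[OF pp] by simp
  then have 1: "aexc n (Pop_T n w cox) = card {j \<in> pm n. key n (w j) < key n (?p j)}"
    using card_prec_eq[OF P(2) w] by (simp add: aexc_def)
  have 2: "aexc n w = card {j \<in> pm n. key n (w j) < key n j}"
    using card_prec_eq[OF id_in_H w] by (simp add: aexc_def)
  \<comment> \<open>If \<open>?p\<close> rises at \<open>j\<close>, then \<open>w j\<close> is not
    strictly between \<open>j\<close> and \<open>?p j\<close>, and both equalities are excluded or
    harmless by \<open>fixp\<close>. If \<open>?p\<close> drops at \<open>j\<close>, it drops from
    the maximum of the block to the minimum, so \<open>w j\<close> lies between them and differs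
    from \<open>j\<close>.\<close>
  have iff: "(key n (w j) < key n j \<longleftrightarrow> key n (w j) < key n (?p j) \<or> key n (?p j) < key n j) \<and>
      \<not> (key n (w j) < key n (?p j) \<and> key n (?p j) < key n j)" if j: "j \<in> pm n" for j
  proof -
    have wj: "w j \<in> orbit ?p j" using P(3)[OF j] step_in_noncrossing_closure[OF j] by auto
    have "?p j = j" if "w j = j"
    proof -
      have "(j, ?p j) \<in> noncrossing_closure w" using P(3)[OF j] orbit.base[of ?p j] by auto
      then show ?thesis using noncrossing_closure_fixpoint[OF pw that] by simp
    qed
    then have fixp: "key n (?p j) = key n j" if "key n (w j) = key n j"
      using k_eqD[OF that] w j by simp
    have "key n (w j) = key n j" if "key n (?p j) = key n j"
    proof -
      have "?p j = j" using k_eqD[OF that] P(2) j by simp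
      then have "orbit ?p j = {j}" using orbit_eq_singleton_iff by metis
      then show ?thesis using wj by simp
    qed
    then show ?thesis
      using fixp rotational_max[OF P(1) j _ wj] rotational_min[OF P(1) j _ wj]
        rotational_no_between[OF P(1) j wj] by linarith
  qed
  have "{j \<in> pm n. key n (w j) < key n j} =
      {j \<in> pm n. key n (w j) < key n (?p j)} \<union> {j \<in> pm n. key n (?p j) < key n j}"
    using iff by blast
  moreover have "{j \<in> pm n. key n (w j) < key n (?p j)} \<inter> {j \<in> pm n. key n (?p j) < key n j} = {}"
    using iff by blast
  ultimately show ?thesis
    unfolding 1 2 cyc_gt1_rotational[OF P(1)] using finite_pm by (simp add: card_Un_disjoint)
qed

lemma aexc_eq_card_wdrop:
  assumes w: "w permutes pm n"
  shows "aexc n w = 2 * n - card (wdrop (inv w))"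
proof -
  have "{i \<in> pm n. prec i (inv w i)} = pm n - wdrop (inv w)"
    using permutes_in_image[OF permutes_inv[OF w]] prec_iff_key by (auto simp: wdrop_def not_le)
  moreover have "card (pm n - wdrop (inv w)) = card (pm n) - card (wdrop (inv w))"
    by (rule card_Diff_subset[OF finite_wdrop]) (auto simp: wdrop_def)
  ultimately show ?thesis by (simp add: aexc_def card_pm)
qed

lemma aexc_inv_cox:
  assumes "n \<ge> 1"
  shows "aexc n (inv cox) = 2 * n - 1"
proof -
  have ne: "pm n \<noteq> {}" using assms card_pm by auto
  have "card (wdrop cox) = 1"
    using ncyc_full_rotation[OF full_rotation_cox ne] rotational_iff[OF cox_permutes]
      full_rotation_cox by (simp add: full_rotation_def)
  then show ?thesis
    using aexc_eq_card_wdrop[OF permutes_inv[OF cox_permutes]] permutes_inv_inv[OF cox_permutes] by simp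
qed

text \<open>More antiexceedances would leave at most one weak drop of \<open>inv w\<close>, hence a
  single cycle that is rotated increasingly, and only \<open>cox\<close> is of this form.\<close>

lemma aexc_le:
  assumes n: "n \<ge> 1" and w: "w permutes pm n" and ne: "w \<noteq> inv cox"
  shows "aexc n w \<le> 2 * n - 2"
proof (rule ccontr)
  assume neg: "\<not> aexc n w \<le> 2 * n - 2"
  let ?v = "inv w"
  have v: "?v permutes pm n" using permutes_inv[OF w] .
  have le1: "card (wdrop ?v) \<le> 1" using neg aexc_eq_card_wdrop[OF w] by linarith
  have nonempty: "pm n \<noteq> {}" using n card_pm by auto
  then have "ncyc ?v \<noteq> 0" using finite_pm by (simp add: ncyc_def)
  then have eq: "ncyc ?v = 1" "card (wdrop ?v) = 1" using le1 ncyc_le_card_wdrop[OF v] by linarith+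
  then have r: "rotational ?v" using rotational_iff[OF v] by simp
  obtain Q where Q: "orbit ?v ` pm n = {Q}" using eq(1) unfolding ncyc_def by (rule card_1_singletonE)
  have o: "orbit ?v i = pm n" if i: "i \<in> pm n" for i
  proof
    show "orbit ?v i \<subseteq> pm n" using orbit_in_X[OF v i] by blast
    show "pm n \<subseteq> orbit ?v i"
    proof
      fix j assume "j \<in> pm n"
      then have "orbit ?v j = orbit ?v i" using Q i by (metis image_eqI singletonD)
      then show "j \<in> orbit ?v i" using self_in_orbit[OF v, of j] by simp
    qed
  qed
  then have "?v = cox"
    using rotational_unique[OF r] full_rotation_cox by (simp add: full_rotation_def)
  then show False using ne permutes_inv_inv[OF w] by simp
qed

end

theorem theorem5p6:
  fixes n :: nat
  assumes "n \<ge> 2"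
  shows "aexc n (inv (coxeter_element n)) = 2 * n - 1 \<and>
    (\<forall>w\<in>hyperoctahedral n. w \<noteq> inv (coxeter_element n) \<longrightarrow> aexc n w \<le> 2 * n - 2) \<and>
    (\<forall>w\<in>hyperoctahedral n.
       int (aexc n (Pop_T n w (coxeter_element n))) =
         int (aexc n w) - int (cyc_gt1 n (pi_T n w (coxeter_element n))))"
proof -
  interpret hyperoct n .
  have n: "n \<ge> 1" using assms by simp
  show ?thesis
    using aexc_inv_cox[OF n] aexc_le[OF n H_permutes] aexc_Pop[OF n] by simp
qed

end
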